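(* Consider the finite-buffer message model described in the context, with buffer size $N$, and where the arrival rate $\lambda=\lambda(N)>0$ and the service time distribution function $B=B_N$ (with mean $1/\mu$, $\mu=\mu(N)$) may depend on $N$. Put $\rho=\lambda/\mu$, $\rho_j=\rho_j(N)=\int_0^\infty(\lambda x)^j\,dB(x)$ and $\widehat B(s)=\int_0^\infty e^{-sx}\,dB(x)$. Let $k\ge1$ be a fixed integer. Suppose that $\rho=1+\delta$ with $\delta=\delta(N)>0$, and that $\delta\,\zeta(N)\to C\ge0$ almost surely as $N\to\infty$ and $\delta\to0$. Assume also that $\rho_3=\rho_3(N)$ is a bounded sequence and that the limit $\widetilde\rho_2=\lim_{N\to\infty}\rho_2(N)$ exists. Then, as $N\to\infty$, $$\mathrm{E}R_{\zeta(N),k}=e^{2C/\widetilde\rho_2}\,\frac{\sum_{i=1}^\infty i\int_0^\infty e^{-\lambda x}\frac{(\lambda x)^{i+k}}{(i+k)!}\,dB(x)}{\widehat B(\lambda)}+o(1),$$ where $\mathrm{E}R_{\zeta(N),k}$ is the expected number of $k$-consecutive refused messages during a busy period, as specified in the context.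
   Context: Model: messages arrive according to a Poisson process of rate $\lambda$ at a single server with i.i.d. service times of distribution $B$. The $i$th message consists of $\kappa_i$ packets, where $\kappa_1,\kappa_2,\dots$ are i.i.d. positive integer random variables with $\mathrm{P}\{\kappa^{lower}\le\kappa_i\le\kappa^{upper}\}=1$ for constants $1\le\kappa^{lower}\le\kappa^{upper}<\infty$ not depending on $N$. For buffer size $N$ put $\zeta(N)=\sup\{m:\sum_{i=1}^m\kappa_i\le N\}$. There are deterministic bounds $\zeta^{lower}\le\zeta(N)\le\zeta^{upper}$ (depending on $N$) holding almost surely, and both tend to infinity as $N\to\infty$. A message is refused if upon arrival the number of messages present exceeds the current (generic) random level distributed as $\zeta(N)$. Auxiliary quantities (for each fixed $N$, with that $\lambda$, $\mu$ and $B$): for the standard $M/GI/1/n$ queue ($n$ waiting places excluding the service place), $T_n$ is a busy period, with $\mathrm{E}T_0=1/\mu$ and, for $n\ge0$, $\mathrm{E}T_n=\sum_{j=0}^{n}\mathrm{E}T_{n-j+1}\int_0^\infty e^{-\lambda x}\frac{(\lambda x)^j}{j!}\,dB(x)$; $L_n$ is the number of losses during a busy period, with $\mathrm{E}L_n=1+(\lambda-\mu)\mathrm{E}T_n$; and for $n,k\ge1$ the expected number of $k$-consecutive losses is (by definition) $\mathrm{E}L_{n,k}=c_{n,k}\mathrm{E}L_n$, where $$c_{n,k}=\frac{\sum_{j=1}^n(\mathrm{E}T_j-\mathrm{E}T_{j-1})\sum_{i=n-j+k+1}^\infty\int_0^\infty e^{-\lambda x}\frac{(\lambda x)^i}{i!}\,dB(x)}{\sum_{j=1}^n(\mathrm{E}T_j-\mathrm{E}T_{j-1})\sum_{i=n-j+2}^\infty\int_0^\infty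 e^{-\lambda x}\frac{(\lambda x)^i}{i!}\,dB(x)}.$$ The expected number of $k$-consecutive refused messages during a busy period is given by the total expectation formula (taken here as definition, for $N$ large enough that $\zeta^{lower}\ge1$): $$\mathrm{E}R_{\zeta(N),k}=\sum_{i=\zeta^{lower}}^{\zeta^{upper}}\mathrm{E}L_{i,k}\,\mathrm{P}\{\zeta(N)=i\}.$$ *)

theory Defs
  imports "HOL-Probability.Probability"
begin

text \<open>
  A service time distribution is a probability measure on the Borel sets of the reals that gives
  no mass to the negative half-line, so that integrals over $[0,\infty)$ with respect to the
  distribution function are plain Lebesgue integrals. A non-integrable function has Lebesgue
  integral 0; since the rate is positive, the equation for the mean entails that the mean is
  finite.
\<close>

definition service_distribution :: "real measure \<Rightarrow> real \<Rightarrow> bool" where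
  "service_distribution B \<mu> \<longleftrightarrow>
     real_distribution B \<and> (AE x in B. 0 \<le> x) \<and> 0 < \<mu> \<and> (LINT x|B. x) = 1 / \<mu>"

definition rho_moment :: "real \<Rightarrow> real measure \<Rightarrow> nat \<Rightarrow> real" where
  "rho_moment l B j = (LINT x|B. (l * x) ^ j)"

definition laplace_stieltjes :: "real measure \<Rightarrow> real \<Rightarrow> real" where
  "laplace_stieltjes B s = (LINT x|B. exp (- s * x))"

definition arrivals_prob :: "real \<Rightarrow> real measure \<Rightarrow> nat \<Rightarrow> real" where
  "arrivals_prob l B i = (LINT x|B. exp (- l * x) * (l * x) ^ i / fact i)"

text \<open>
  The expected busy period $\mathrm{E}T_n$ of the $M/GI/1/n$ queue: the recurrence
  $\mathrm{E}T_n = \sum_{j=0}^{n} \mathrm{E}T_{n-j+1}\, a_j$, with $a_j$ given by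
  \<open>arrivals_prob\<close>, is solved for the term of highest index. The two lemmas below show that this
  is the unique solution of the recurrence in its original form.
\<close>

fun mean_busy :: "real \<Rightarrow> real \<Rightarrow> real measure \<Rightarrow> nat \<Rightarrow> real" where
  "mean_busy l \<mu> B 0 = 1 / \<mu>"
| "mean_busy l \<mu> B (Suc n) =
     (mean_busy l \<mu> B n - (\<Sum>j=1..n. mean_busy l \<mu> B (n - j + 1) * arrivals_prob l B j))
       / arrivals_prob l B 0"

declare mean_busy.simps(2) [simp del] \<comment> \<open>the recursive calls have the form \<open>Suc _\<close> and unfold forever\<close>

lemma arrivals_prob_0_pos:
  assumes "real_distribution B" "AE x in B. 0 \<le> x" "0 < l"
  shows "0 < arrivals_prob l B 0"
proof -
  interpret real_distribution B by fact
  have int: "integrable B (\<lambda>x. exp (- l * x))"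
    by (rule integrable_const_bound[where B = 1]) (use assms in auto)
  have "0 \<le> (LINT x|B. exp (- l * x))" by simp
  moreover have "(LINT x|B. exp (- l * x)) \<noteq> 0"
    using integral_nonneg_eq_0_iff_AE[OF int] by simp
  ultimately have "0 < (LINT x|B. exp (- l * x))" by linarith
  then show ?thesis by (simp add: arrivals_prob_def)
qed

lemma mean_busy_recurrence:
  assumes "real_distribution B" "AE x in B. 0 \<le> x" "0 < l"
  shows "mean_busy l \<mu> B n = (\<Sum>j=0..n. mean_busy l \<mu> B (n - j + 1) * arrivals_prob l B j)"
proof -
  have "arrivals_prob l B 0 \<noteq> 0" using arrivals_prob_0_pos[OF assms] by simp
  then have "mean_busy l \<mu> B (Suc n) * arrivals_prob l B 0
      = mean_busy l \<mu> B n - (\<Sum>j=1..n. mean_busy l \<mu> B (n - j + 1) * arrivals_prob l B j)"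
    by (simp only: mean_busy.simps(2) nonzero_divide_eq_eq times_divide_eq_left) simp
  then show ?thesis by (simp add: sum.atLeast_Suc_atMost[of 0 n])
qed

lemma mean_busy_unique:
  assumes B: "real_distribution B" "AE x in B. 0 \<le> x" "0 < l"
    and T0: "T 0 = 1 / \<mu>"
    and T: "\<And>n. T n = (\<Sum>j=0..n. T (n - j + 1) * arrivals_prob l B j)"
  shows "T n = mean_busy l \<mu> B n"
proof (induction n rule: less_induct)
  case (less n)
  have a0: "arrivals_prob l B 0 \<noteq> 0" using arrivals_prob_0_pos[OF B] by simp
  show ?case
  proof (cases n)
    case 0
    then show ?thesis using T0 by simp
  next
    case (Suc m)
    have "T m = T (Suc m) * arrivals_prob l B 0
        + (\<Sum>j=1..m. T (m - j + 1) * arrivals_prob l B j)"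
      by (subst T) (simp add: sum.atLeast_Suc_atMost[of 0 m])
    moreover have "(\<Sum>j=1..m. T (m - j + 1) * arrivals_prob l B j)
        = (\<Sum>j=1..m. mean_busy l \<mu> B (m - j + 1) * arrivals_prob l B j)"
      by (intro sum.cong refl arg_cong2[where f = "(*)"] less) (use Suc in auto)
    moreover have "T m = mean_busy l \<mu> B m" using less Suc by simp
    ultimately show ?thesis using a0 unfolding Suc mean_busy.simps(2) by (simp add: eq_divide_eq)
  qed
qed

definition mean_losses :: "real \<Rightarrow> real \<Rightarrow> real measure \<Rightarrow> nat \<Rightarrow> real" where
  "mean_losses l \<mu> B n = 1 + (l - \<mu>) * mean_busy l \<mu> B n"

text \<open>The coefficient $c_{n,k}$; it is meant for $n, k \ge 1$.\<close>

definition consec_coeff :: "real \<Rightarrow> real \<Rightarrow> real measure \<Rightarrow> nat \<Rightarrow> nat \<Rightarrow> real" where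
  "consec_coeff l \<mu> B n k =
     (\<Sum>j=1..n. (mean_busy l \<mu> B j - mean_busy l \<mu> B (j - 1)) *
        (\<Sum>\<^sub>\<infinity>i\<in>{n - j + k + 1..}. arrivals_prob l B i)) /
     (\<Sum>j=1..n. (mean_busy l \<mu> B j - mean_busy l \<mu> B (j - 1)) *
        (\<Sum>\<^sub>\<infinity>i\<in>{n - j + 2..}. arrivals_prob l B i))"

definition mean_consec_losses :: "real \<Rightarrow> real \<Rightarrow> real measure \<Rightarrow> nat \<Rightarrow> nat \<Rightarrow> real" where
  "mean_consec_losses l \<mu> B n k = consec_coeff l \<mu> B n k * mean_losses l \<mu> B n"

text \<open>
  The number of messages that fit into a buffer of \<open>N\<close> packets. Packet counts are indexed from 1.
  The supremum is a maximum as soon as all packet counts are positive, which holds almost surely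
  below; on the exceptional null set it may be an unspecified number.
\<close>

definition zeta :: "(nat \<Rightarrow> 'a \<Rightarrow> nat) \<Rightarrow> nat \<Rightarrow> 'a \<Rightarrow> nat" where
  "zeta \<kappa> N \<omega> = Sup {m. (\<Sum>i=1..m. \<kappa> i \<omega>) \<le> N}"

definition packet_sequence :: "'a measure \<Rightarrow> (nat \<Rightarrow> 'a \<Rightarrow> nat) \<Rightarrow> nat \<Rightarrow> nat \<Rightarrow> bool" where
  "packet_sequence M \<kappa> \<kappa>lo \<kappa>up \<longleftrightarrow>
     prob_space.indep_vars M (\<lambda>_. count_space UNIV) \<kappa> {1..} \<and>
     (\<forall>i\<ge>1. distr M (count_space UNIV) (\<kappa> i) = distr M (count_space UNIV) (\<kappa> 1)) \<and>
     1 \<le> \<kappa>lo \<and> \<kappa>lo \<le> \<kappa>up \<and>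
     (\<forall>i\<ge>1. measure M {\<omega> \<in> space M. \<kappa>lo \<le> \<kappa> i \<omega> \<and> \<kappa> i \<omega> \<le> \<kappa>up} = 1)"

text \<open>
  The total expectation formula for the expected number of \<open>k\<close>-consecutive refused messages
  during a busy period; \<open>zlo\<close> and \<open>zup\<close> are the values at \<open>N\<close> of the deterministic bounds on
  \<open>zeta \<kappa> N\<close>. It is meant for \<open>zlo \<ge> 1\<close>.
\<close>

definition mean_consec_refused ::
  "'a measure \<Rightarrow> (nat \<Rightarrow> 'a \<Rightarrow> nat) \<Rightarrow> nat \<Rightarrow> nat \<Rightarrow> real \<Rightarrow> real \<Rightarrow> real measure \<Rightarrow> nat \<Rightarrow> nat \<Rightarrow> real"
  where
  "mean_consec_refused M \<kappa> zlo zup l \<mu> B N k =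
     (\<Sum>i=zlo..zup. mean_consec_losses l \<mu> B i k * measure M {\<omega> \<in> space M. zeta \<kappa> N \<omega> = i})"

end

theory Submission
  imports Defs
begin

text \<open>
  Let $a_i$ be the arrival probabilities and $f_m = \sum_{i>m} a_i$. The recurrence for the mean busy
  periods says that the increments $D_n$ of $\mu\,\mathrm{E}T_n$ solve the renewal equation
  $D = a + f * D$. Here $f$ has mass $1+\delta$ and mean $\rho_2/2$. Tilting by the root $z<1$ of
  $\sum f_m z^m = 1$ turns $f$ into a probability distribution, and a renewal theorem that is uniform
  over distributions with bounded second moment and with mass at 1 bounded below gives
  $z^n D_n \to 2/\rho_2$ as $n$ and $N$ tend to infinity. Both sums in $c_{n,k}$ are convolutions of $D$
  with shifts of $f$, and $\mathrm{E}L_n$ is essentially the convolution of $D$ with the tails of $f$,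
  whose mass is $\rho_2/2$; all three are therefore asymptotic to $z^{-n}\,(2/\rho_2)$ times the mass of
  the other factor. As $(1-z)/\delta \to 2/\rho_2$, we have $z^{-n} \to e^{2C/\rho_2}$ when $\delta n \to C$.
  Applied along almost every sample path of $\zeta(N)$, this yields the theorem by dominated
  convergence.
\<close>

subsection \<open>Tails and renewal equations\<close>

text \<open>The distributions \<open>B N\<close> vary with \<open>N\<close> and need not converge. A
  renewal theorem for one fixed step distribution is therefore of no use, and
  \<open>\<Phi> N k / q.a N 0\<close> need not have a limit: the estimates are uniform over a class
  described by constants, and the results say that differences tend to 0. The lower bound for the
  mass at 1 comes from monotonicity. Since \<open>f\<close> decreases and
  \<open>f 0 = 1 - a 0\<close>, Jensen's inequality for \<open>a 0\<close> leaves a fixed amount of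
  mass away from 0, and the bounded mean keeps it from escaping to infinity, so \<open>f 1\<close>
  cannot be small. In the renewal theorem the increments of the solution are shown to vanish first.
  The solution is then almost constant on a long window, and the exact identity for its convolution
  with the tails of \<open>f\<close> determines the constant. The third moment enters as the mean of
  these tails: it makes the part outside the window small, and it controls the second-order error in
  comparing \<open>\<delta>\<close> with \<open>1 - z\<close>. The dominating constant needs
  \<open>\<delta> N * N\<close> bounded, which holds because a message has at most
  \<open>\<kappa>up\<close> packets.\<close>

text \<open>The tail is strict: the term of index \<open>m\<close> itself is left out.\<close>

definition tail_sum :: "(nat \<Rightarrow> real) \<Rightarrow> nat \<Rightarrow> real" where
  "tail_sum a m = (\<Sum>i. a (i + Suc m))"

lemma tail_sum_eq:
  assumes "a sums s"
  shows "tail_sum a m = s - (\<Sum>i\<le>m. a i)"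
  using suminf_minus_initial_segment[of a "Suc m"] assms
  by (simp add: tail_sum_def sums_iff lessThan_Suc_atMost)

lemma tail_sum_step:
  assumes "summable a"
  shows "tail_sum a m = a (Suc m) + tail_sum a (Suc m)"
  using tail_sum_eq[OF summable_sums[OF assms]] by simp

lemma tail_sum_nonneg:
  assumes "summable a" "\<And>i. 0 \<le> a i"
  shows "0 \<le> tail_sum a m"
  unfolding tail_sum_def using assms by (intro suminf_nonneg) (simp_all del: add_Suc_right)

lemma tail_sum_antimono:
  assumes "summable a" "\<And>i. 0 \<le> a i" "m \<le> n"
  shows "tail_sum a n \<le> tail_sum a m"
  using assms(3)
proof (induction rule: dec_induct)
  case (step j)
  then show ?case using tail_sum_step[OF assms(1), of j] assms(2)[of "Suc j"] by linarith
qed simp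

lemma tail_sum_tendsto_0: "summable a \<Longrightarrow> tail_sum a \<longlonglongrightarrow> 0"
proof -
  assume a: "summable a"
  have "(\<lambda>m. suminf a - (\<Sum>i\<le>m. a i)) \<longlonglongrightarrow> suminf a - suminf a"
    using summable_LIMSEQ'[OF a] by (intro tendsto_intros)
  moreover have "tail_sum a = (\<lambda>m. suminf a - (\<Sum>i\<le>m. a i))"
    using tail_sum_eq[OF summable_sums[OF a]] by (simp add: fun_eq_iff)
  ultimately show ?thesis by simp
qed

text \<open>Markov's inequality for a nondecreasing weight \<open>w\<close>. On the right stands the
  weighted tail, not the whole weighted sum: it tends to 0, and this removes the boundary term in
  \<open>tail_sum_moments\<close>.\<close>

lemma mult_tail_sum_le:
  assumes "summable a" "\<And>i. 0 \<le> a i" "incseq w" "summable (\<lambda>i. w i * a i)"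
  shows "w (Suc m) * tail_sum a m \<le> tail_sum (\<lambda>i. w i * a i) m"
proof -
  have 1: "summable (\<lambda>i. a (i + Suc m))" using assms(1) by (simp del: add_Suc_right)
  have 2: "summable (\<lambda>i. w (i + Suc m) * a (i + Suc m))"
    using summable_ignore_initial_segment[OF assms(4)] .
  have "w (Suc m) * tail_sum a m = (\<Sum>i. w (Suc m) * a (i + Suc m))"
    unfolding tail_sum_def using suminf_mult[OF 1] by simp
  also have "\<dots> \<le> (\<Sum>i. w (i + Suc m) * a (i + Suc m))"
    using assms(2) incseqD[OF assms(3)]
    by (intro suminf_le mult_right_mono summable_mult 1 2) (auto simp del: add_Suc_right)
  finally show ?thesis unfolding tail_sum_def .
qed

text \<open>Binomial coefficients in place of powers make the formula exact and let it be iterated: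
  each passage to tails lowers the order by one and keeps the value \<open>s\<close>.\<close>

lemma tail_sum_moments:
  assumes a: "summable a" "\<And>i. 0 \<le> a i"
    and s: "(\<lambda>i. real (i choose Suc r) * a i) sums s"
  shows "(\<lambda>m. real (m choose r) * tail_sum a m) sums s"
proof -
  \<comment> \<open>Abel summation, using the hockey-stick identity\<close>
  have *: "(\<Sum>m<M. real (m choose r) * tail_sum a m)
      = (\<Sum>i\<le>M. real (i choose Suc r) * a i) + real (M choose Suc r) * tail_sum a M" for M
  proof (induction M)
    case (Suc M)
    then show ?case
      using tail_sum_step[OF a(1), of M] by (simp add: algebra_simps)
  qed simp
  have mono: "incseq (\<lambda>i. real (i choose Suc r))"
    by (intro monoI) (simp add: binomial_right_mono)
  have "(\<lambda>M. real (M choose Suc r) * tail_sum a M) \<longlonglongrightarrow> 0"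
  proof (rule tendsto_sandwich)
    show "\<forall>\<^sub>F M in sequentially. 0 \<le> real (M choose Suc r) * tail_sum a M"
      using tail_sum_nonneg[OF a] by simp
    show "\<forall>\<^sub>F M in sequentially. real (M choose Suc r) * tail_sum a M
        \<le> tail_sum (\<lambda>i. real (i choose Suc r) * a i) M"
    proof (intro always_eventually allI)
      fix M
      have "real (M choose Suc r) * tail_sum a M \<le> real (Suc M choose Suc r) * tail_sum a M"
        using incseqD[OF mono, of M "Suc M"] tail_sum_nonneg[OF a] by (intro mult_right_mono) auto
      also have "\<dots> \<le> tail_sum (\<lambda>i. real (i choose Suc r) * a i) M"
        using mult_tail_sum_le[OF a mono] s by (simp add: sums_iff)
      finally show "real (M choose Suc r) * tail_sum a M
        \<le> tail_sum (\<lambda>i. real (i choose Suc r) * a i) M" .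
    qed
    show "tail_sum (\<lambda>i. real (i choose Suc r) * a i) \<longlonglongrightarrow> 0"
      using s by (intro tail_sum_tendsto_0) (simp add: sums_iff)
  qed simp
  moreover have "(\<lambda>M. \<Sum>i\<le>M. real (i choose Suc r) * a i) \<longlonglongrightarrow> s"
    using s by (simp add: sums_def_le)
  ultimately have "(\<lambda>M. (\<Sum>i\<le>M. real (i choose Suc r) * a i) + real (M choose Suc r) * tail_sum a M)
      \<longlonglongrightarrow> s + 0"
    by (rule tendsto_add[rotated])
  then show ?thesis unfolding sums_def * by simp
qed

lemma tail_sum_sums:
  assumes "summable a" "\<And>i. 0 \<le> a i" "(\<lambda>i. real i * a i) sums s"
  shows "tail_sum a sums s"
  using tail_sum_moments[of a 0 s] assms by simp

lemma index_mult_tail_sum_le: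
  assumes a: "summable a" "\<And>i. 0 \<le> a i" and s: "(\<lambda>i. real i * a i) sums s"
  shows "real (Suc m) * tail_sum a m \<le> s"
proof -
  have "real (Suc m) * tail_sum a m \<le> tail_sum (\<lambda>i. real i * a i) m"
    using s by (intro mult_tail_sum_le a) (auto simp: sums_iff mono_def)
  also have "\<dots> \<le> s"
    using tail_sum_eq[OF s] a(2) by (simp add: sum_nonneg)
  finally show ?thesis .
qed

lemma summable_lower_moment:
  assumes "\<And>i. 0 \<le> a i" "summable (\<lambda>i. real i ^ r * a i)" "q \<le> r"
  shows "summable (\<lambda>i. real i ^ q * a i)"
proof (rule summable_comparison_test_ev[OF _ assms(2)])
  show "\<forall>\<^sub>F n in sequentially. norm (real n ^ q * a n) \<le> real n ^ r * a n"
    using eventually_ge_at_top[of 1]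
  proof eventually_elim
    case (elim n)
    then show ?case using assms(1,3) by (auto intro!: mult_right_mono power_increasing)
  qed
qed

section \<open>Renewal equations: tail identity, positivity, increments\<close>

definition renewal_eq :: "(nat \<Rightarrow> real) \<Rightarrow> (nat \<Rightarrow> real) \<Rightarrow> (nat \<Rightarrow> real) \<Rightarrow> bool" where
  "renewal_eq f b x \<longleftrightarrow> (\<forall>n. x n = b n + (\<Sum>m\<le>n. f m * x (n - m)))"

text \<open>Raising \<open>n\<close> by one replaces \<open>tail_sum f m\<close> by
  \<open>tail_sum f (Suc m)\<close>, which subtracts \<open>f (Suc m)\<close>, and the renewal
  equation evaluates what is subtracted. For \<open>s = 1\<close> this is an exact conservation law;
  an excess of mass brings in the sum of \<open>x\<close>.\<close>

lemma renewal_tail_identity: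
  assumes "renewal_eq f b x" "f sums s"
  shows "(\<Sum>m\<le>n. tail_sum f m * x (n - m)) = (\<Sum>j\<le>n. b j) + (s - 1) * (\<Sum>j\<le>n. x j)"
proof (induction n)
  case 0
  have b: "b 0 = x 0 - f 0 * x 0" using assms(1)[unfolded renewal_eq_def, rule_format, of 0] by simp
  have t: "tail_sum f 0 = s - f 0" using tail_sum_eq[OF assms(2), of 0] by simp
  show ?case by (simp add: b t left_diff_distrib)
next
  case (Suc n)
  have "(\<Sum>m\<le>Suc n. tail_sum f m * x (Suc n - m))
      = tail_sum f 0 * x (Suc n) + (\<Sum>m\<le>n. tail_sum f (Suc m) * x (n - m))"
    by (subst sum.atMost_Suc_shift) simp
  also have "(\<Sum>m\<le>n. tail_sum f (Suc m) * x (n - m))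
      = (\<Sum>m\<le>n. tail_sum f m * x (n - m)) - (\<Sum>m\<le>n. f (Suc m) * x (n - m))"
  proof -
    have "tail_sum f (Suc m) = tail_sum f m - f (Suc m)" for m
      using tail_sum_step[of f m] assms(2) by (simp add: sums_iff)
    then show ?thesis by (simp add: sum_subtractf left_diff_distrib)
  qed
  also have "(\<Sum>m\<le>n. f (Suc m) * x (n - m)) = x (Suc n) - b (Suc n) - f 0 * x (Suc n)"
    using assms(1)[unfolded renewal_eq_def, rule_format, of "Suc n"]
    by (subst (asm) sum.atMost_Suc_shift) simp
  finally show ?case using Suc tail_sum_eq[OF assms(2), of 0] by (simp add: algebra_simps)
qed

text \<open>The term \<open>f 0 * x n\<close> refers to \<open>x n\<close> itself. Moving it to the
  left leaves the positive factor \<open>1 - f 0\<close>, and only earlier values remain on the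
  right.\<close>

lemma renewal_nonneg:
  assumes "renewal_eq f b x" "\<And>m. 0 \<le> f m" "f 0 < 1" "\<And>m. 0 \<le> b m"
  shows "0 \<le> x n"
proof (induction n rule: less_induct)
  case (less n)
  have "x n = b n + (f 0 * x n + (\<Sum>m=1..n. f m * x (n - m)))"
    using assms(1)[unfolded renewal_eq_def, rule_format, of n]
    by (simp add: atMost_atLeast0 sum.atLeast_Suc_atMost[of 0 n])
  then have "(1 - f 0) * x n = b n + (\<Sum>m=1..n. f m * x (n - m))" by (simp add: algebra_simps)
  moreover have "0 \<le> (\<Sum>m=1..n. f m * x (n - m))"
    using assms(2) less by (intro sum_nonneg mult_nonneg_nonneg) auto
  ultimately have "0 \<le> (1 - f 0) * x n" using assms(4)[of n] by linarith
  then show ?case using assms(3) by (simp add: zero_le_mult_iff)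
qed

text \<open>The convention is that \<open>x\<close> vanishes before index 0: partial sums give back
  \<open>x\<close> without a constant, and a renewal equation passes to increments at index 0
  too.\<close>

definition increment :: "(nat \<Rightarrow> real) \<Rightarrow> nat \<Rightarrow> real" where
  "increment x n = (if n = 0 then x 0 else x n - x (n - 1))"

lemma increment_simps [simp]: "increment x 0 = x 0" "increment x (Suc n) = x (Suc n) - x n"
  by (auto simp: increment_def)

lemma sum_increment: "(\<Sum>i\<le>n. increment x i) = x n"
  by (induction n) auto

lemma renewal_eq_increment:
  assumes "renewal_eq f b x"
  shows "renewal_eq f (increment b) (increment x)"
  unfolding renewal_eq_def
proof
  fix n
  show "increment x n = increment b n + (\<Sum>m\<le>n. f m * increment x (n - m))"
  proof (cases n)
    case 0
    then show ?thesis using assms[unfolded renewal_eq_def, rule_format, of 0] by simp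
  next
    case (Suc k)
    have "(\<Sum>m\<le>Suc k. f m * increment x (Suc k - m))
        = (\<Sum>m\<le>k. f m * (x (Suc k - m) - x (k - m))) + f (Suc k) * x 0"
      by (auto simp: Suc_diff_le intro!: sum.cong)
    also have "\<dots> = (\<Sum>m\<le>Suc k. f m * x (Suc k - m)) - (\<Sum>m\<le>k. f m * x (k - m))"
      by (simp add: algebra_simps sum_subtractf)
    finally show ?thesis
      using assms[unfolded renewal_eq_def, rule_format, of k]
        assms[unfolded renewal_eq_def, rule_format, of "Suc k"]
      by (simp add: Suc)
  qed
qed

subsection \<open>A uniform renewal theorem\<close>

text \<open>Modelled on the increments \<open>d\<close> of a solution of a renewal equation: their
  defect is the increment of the forcing term, hence of order \<open>1 / n\<close>, and their block
  sums telescope to differences of the solution. A single \<open>K\<close> for all bounds makes the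
  class closed under \<open>d\<close> to \<open>- d\<close>.\<close>

definition nearly_harmonic :: "real \<Rightarrow> real \<Rightarrow> (nat \<Rightarrow> real) \<Rightarrow> (nat \<Rightarrow> real) \<Rightarrow> bool" where
  "nearly_harmonic c K f d \<longleftrightarrow>
     (\<forall>m. 0 \<le> f m) \<and> f sums 1 \<and> c \<le> f 1 \<and> (\<forall>m. real (Suc m) * tail_sum f m \<le> K) \<and>
     (\<forall>n. \<bar>d n\<bar> \<le> K) \<and> (\<forall>n. real n * \<bar>d n - (\<Sum>m\<le>n. f m * d (n - m))\<bar> \<le> K) \<and>
     (\<forall>n p. \<bar>\<Sum>i<p. d (n + i)\<bar> \<le> K)"

lemma nearly_harmonic_uminus:
  "nearly_harmonic c K f d \<Longrightarrow> nearly_harmonic c K f (\<lambda>n. - d n)"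
  unfolding nearly_harmonic_def
  by (simp add: sum_negf abs_minus_commute)

text \<open>
  Let \<open>s\<close> be the infimum of the eventual uniform upper bounds of \<open>d\<close>. If \<open>d n\<close> is almost \<open>s\<close>, then so
  is \<open>d (n - 1)\<close>, since it has weight at least \<open>c\<close> in an average of values that hardly exceed \<open>s\<close>.
  Going back \<open>M\<close> steps produces a sum of about \<open>M * s\<close>, which is bounded by \<open>K\<close>; so \<open>s \<le> 0\<close>.
\<close>

lemma nearly_harmonic_le:
  assumes "0 < c" "0 < K" "0 < \<epsilon>"
  shows "\<exists>n0. \<forall>f d. nearly_harmonic c K f d \<longrightarrow> (\<forall>n\<ge>n0. d n \<le> \<epsilon>)"
proof (rule ccontr)
  define P where "P t \<longleftrightarrow> (\<exists>n0. \<forall>f d. nearly_harmonic c K f d \<longrightarrow> (\<forall>n\<ge>n0. d n \<le> t))" for t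
  assume "\<not> ?thesis"
  then have nP: "\<not> P \<epsilon>" unfolding P_def .
  have up: "P t'" if Pt: "P t" and le: "t \<le> t'" for t t'
  proof -
    obtain n0 where "\<And>f d n. nearly_harmonic c K f d \<Longrightarrow> n0 \<le> n \<Longrightarrow> d n \<le> t"
      using Pt unfolding P_def by blast
    then have "\<And>f d n. nearly_harmonic c K f d \<Longrightarrow> n0 \<le> n \<Longrightarrow> d n \<le> t'"
      using le by (rule order_trans)
    then show ?thesis unfolding P_def by blast
  qed
  have PK: "P K" unfolding P_def nearly_harmonic_def by (auto simp: abs_le_iff)
  \<comment> \<open>Every \<open>t\<close> with \<open>P t\<close> exceeds
    \<open>\<epsilon>\<close>, because \<open>P \<epsilon>\<close> fails and \<open>P\<close> is
    upward closed; so the infimum is positive. It need not be attained.\<close>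
  define s where "s = Inf {t. P t}"
  have lower: "\<epsilon> \<le> t" if "P t" for t using up[OF that, of \<epsilon>] nP by linarith
  have bdd: "bdd_below {t. P t}" using lower by (intro bdd_belowI[of _ \<epsilon>]) auto
  have "\<epsilon> \<le> s" unfolding s_def using PK lower by (intro cInf_greatest) auto
  then have s_pos: "0 < s" using assms(3) by linarith
  have above: "P t" if st: "s < t" for t
  proof -
    obtain t' where "P t'" "t' < t" using st cInf_lessD[of "{t. P t}" t] PK unfolding s_def by blast
    then show ?thesis using up[of t' t] by simp
  qed
  have below: "\<not> P t" if "t < s" for t
    using that cInf_lower[OF _ bdd, of t] unfolding s_def by auto
  \<comment> \<open>\<open>M\<close> consecutive values of size at least \<open>s / 2\<close> add up
    to more than \<open>K\<close>.\<close>
  obtain M :: nat where M: "2 * K / s < real M" using reals_Archimedean2 by blast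
  \<comment> \<open>Growth of the error per step back: from \<open>w = \<eta> * r ^ j\<close>, which
    is at least \<open>\<eta>\<close>, the new error \<open>(w + 3 * \<eta>) / c\<close> is at most
    \<open>w * (4 / c)\<close>.\<close>
  define r where "r = max 1 (4 / c)"
  have r: "1 \<le> r" "4 / c \<le> r" unfolding r_def by auto
  \<comment> \<open>Chosen so that the error has grown to exactly \<open>s / 2\<close> after
    \<open>M\<close> steps.\<close>
  define \<eta> where "\<eta> = s / (2 * r ^ M)"
  have \<eta>: "0 < \<eta>" unfolding \<eta>_def using s_pos r by simp
  obtain n1 where n1: "\<And>f d n. nearly_harmonic c K f d \<Longrightarrow> n1 \<le> n \<Longrightarrow> d n \<le> s + \<eta>"
    using above[of "s + \<eta>"] \<eta> unfolding P_def by auto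
  \<comment> \<open>Past index \<open>I\<close> the defect is at most \<open>K / I\<close>, and the
    steps longer than \<open>I\<close> contribute at most \<open>K * K / I\<close>; both are below
    \<open>\<eta>\<close>.\<close>
  obtain I :: nat where I: "(K + K * K) / \<eta> < real I" using reals_Archimedean2 by blast
  \<comment> \<open>After \<open>M\<close> steps back from \<open>n\<close>, looking back by a
    further \<open>I\<close> still stays in the range where \<open>n1\<close> gives the upper bound.
    The sequences are obtained only now, so \<open>n1\<close> had to serve the whole class.\<close>
  define n2 where "n2 = n1 + I + M + 1"
  obtain f d n where nh: "nearly_harmonic c K f d" and n: "n2 \<le> n" and dn: "s - \<eta> < d n"
  proof -
    have "\<not> (\<forall>f d. nearly_harmonic c K f d \<longrightarrow> (\<forall>n\<ge>n2. d n \<le> s - \<eta>))"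
      using below[of "s - \<eta>"] \<eta> unfolding P_def by auto
    then show ?thesis using that unfolding not_all not_imp not_le by blast
  qed
  have f0: "\<And>m. 0 \<le> f m" and f1: "f sums 1" and fc: "c \<le> f 1"
    and ft: "\<And>m. real (Suc m) * tail_sum f m \<le> K" and dK: "\<And>n. \<bar>d n\<bar> \<le> K"
    and de: "\<And>n. real n * \<bar>d n - (\<Sum>m\<le>n. f m * d (n - m))\<bar> \<le> K"
    and dp: "\<And>n p. \<bar>\<Sum>i<p. d (n + i)\<bar> \<le> K"
    using nh unfolding nearly_harmonic_def by blast+
  have I0: "0 < real I" 
  proof -
    have "0 \<le> (K + K * K) / \<eta>" using assms \<eta> by simp
    then show ?thesis using I by linarith
  qed
  have IK: "K + K * K < real I * \<eta>" using I \<eta> by (simp add: divide_less_eq)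
  have tI: "tail_sum f I * K \<le> \<eta>"
  proof -
    have "real I * tail_sum f I \<le> K"
      using ft[of I] tail_sum_nonneg[of f I] f1 f0 by (simp add: sums_iff algebra_simps)
    then have "real I * (tail_sum f I * K) \<le> K * K"
      using assms(2) mult_right_mono[of "real I * tail_sum f I" K K] by (simp add: mult.assoc)
    also have "\<dots> \<le> real I * \<eta>" using IK assms(2) by linarith
    finally show ?thesis using I0 by simp
  qed
  \<comment> \<open>The three copies of \<open>\<eta>\<close> are the defect, the terms beyond
    \<open>I\<close>, and the possible excess of the near terms over \<open>s\<close>.\<close>
  have step: "s - (w + 3 * \<eta>) / c \<le> d (p - 1)" if p: "n1 + I + 1 \<le> p" and w: "s - w \<le> d p" "0 \<le> w" for p w
  proof -
    have I1: "1 \<le> I" using I0 by simp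
    have "real I * \<bar>d p - (\<Sum>m\<le>p. f m * d (p - m))\<bar> \<le> real p * \<bar>d p - (\<Sum>m\<le>p. f m * d (p - m))\<bar>"
      using p by (intro mult_right_mono) auto
    also have "\<dots> \<le> K" by (rule de)
    also have "\<dots> \<le> real I * \<eta>" using IK mult_pos_pos[OF assms(2) assms(2)] by linarith
    finally have e: "\<bar>d p - (\<Sum>m\<le>p. f m * d (p - m))\<bar> \<le> \<eta>" using I0 by simp
    have split: "(\<Sum>m\<le>p. h m) = (\<Sum>m\<le>I. h m) + (\<Sum>m\<in>{Suc I..p}. h m)" for h :: "nat \<Rightarrow> real"
      using p by (subst sum.union_disjoint[symmetric]) (auto intro!: sum.cong)
    have far: "(\<Sum>m\<in>{Suc I..p}. f m * d (p - m)) \<le> \<eta>"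
    proof -
      have "(\<Sum>m\<in>{Suc I..p}. f m * d (p - m)) \<le> (\<Sum>m\<in>{Suc I..p}. f m * K)"
        using f0 dK by (intro sum_mono mult_left_mono) (auto simp: abs_le_iff)
      also have "\<dots> = ((\<Sum>m\<le>p. f m) - (\<Sum>m\<le>I. f m)) * K"
        using split[of f] by (simp add: sum_distrib_right)
      also have "\<dots> \<le> tail_sum f I * K"
        using tail_sum_eq[OF f1, of I] tail_sum_eq[OF f1, of p] tail_sum_nonneg[of f p] f1 f0 assms(2)
        by (intro mult_right_mono) (auto simp: sums_iff)
      finally show ?thesis using tI by linarith
    qed
    have near: "(\<Sum>m\<le>I. f m * d (p - m)) \<le> f 1 * d (p - 1) + (1 - f 1) * (s + \<eta>)"
    proof -
      have rem: "(\<Sum>m\<le>I. h m) = h 1 + (\<Sum>m\<in>{..I} - {1}. h m)" for h :: "nat \<Rightarrow> real"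
        using I1 by (intro sum.remove) auto
      have "(\<Sum>m\<in>{..I} - {1}. f m * d (p - m)) \<le> (\<Sum>m\<in>{..I} - {1}. f m * (s + \<eta>))"
        using f0 n1[OF nh] p by (intro sum_mono mult_left_mono) auto
      also have "\<dots> = ((\<Sum>m\<le>I. f m) - f 1) * (s + \<eta>)"
        unfolding rem[of f] by (simp add: sum_distrib_right)
      also have "\<dots> \<le> (1 - f 1) * (s + \<eta>)"
        using tail_sum_eq[OF f1, of I] tail_sum_nonneg[of f I] f1 f0 s_pos \<eta>
        by (intro mult_right_mono) (auto simp: sums_iff)
      finally show ?thesis unfolding rem by linarith
    qed
    from e[unfolded split] w far near have "s - w \<le> f 1 * d (p - 1) + (1 - f 1) * (s + \<eta>) + 2 * \<eta>"
      by linarith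
    moreover have "0 \<le> f 1 * \<eta>" using f0 \<eta> by simp
    ultimately have "f 1 * (s - d (p - 1)) \<le> w + 3 * \<eta>" by (simp add: algebra_simps)
    then have "s - d (p - 1) \<le> (w + 3 * \<eta>) / f 1"
      using fc assms(1) by (simp add: le_divide_eq mult.commute)
    also have "\<dots> \<le> (w + 3 * \<eta>) / c"
      using fc assms(1) w \<eta> by (intro divide_left_mono mult_pos_pos) auto
    finally show ?thesis by linarith
  qed
  have descent: "s - \<eta> * r ^ j \<le> d (n - j)" if "j \<le> M" for j
    using that
  proof (induction j)
    case 0
    then show ?case using dn by simp
  next
    case (Suc j)
    have "1 \<le> r ^ j" using r by simp
    then have "\<eta> * 3 \<le> \<eta> * (3 * r ^ j)" using \<eta> by (intro mult_left_mono) auto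
    then have "(\<eta> * r ^ j + 3 * \<eta>) / c \<le> (4 * (\<eta> * r ^ j)) / c"
      using assms(1) by (intro divide_right_mono) auto
    also have "\<dots> = \<eta> * r ^ j * (4 / c)" by simp
    also have "\<dots> \<le> \<eta> * r ^ j * r" using r \<eta> by (intro mult_left_mono) auto
    finally have "(\<eta> * r ^ j + 3 * \<eta>) / c \<le> \<eta> * r ^ Suc j" by (simp add: mult_ac)
    moreover have "s - (\<eta> * r ^ j + 3 * \<eta>) / c \<le> d (n - j - 1)"
      using Suc n \<eta> r unfolding n2_def by (intro step) auto
    ultimately show ?case by simp
  qed
  have half: "s / 2 \<le> d (n - j)" if "j \<le> M" for j
  proof -
    have "\<eta> * r ^ j \<le> \<eta> * r ^ M" using \<eta> r that by (intro mult_left_mono power_increasing) auto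
    also have "\<dots> = s / 2" unfolding \<eta>_def using r by simp
    finally show ?thesis using descent[OF that] by linarith
  qed
  have "real M * (s / 2) = (\<Sum>i<M. s / 2)" by simp
  also have "\<dots> \<le> (\<Sum>i<M. d (n - M + i))"
  proof (rule sum_mono)
    fix i assume "i \<in> {..<M}"
    then have "n - M + i = n - (M - i)" using n unfolding n2_def by auto
    then show "s / 2 \<le> d (n - M + i)" using half[of "M - i"] by simp
  qed
  also have "\<dots> \<le> K" using dp[where n = "n - M" and p = M] by linarith
  finally show False using M s_pos by (simp add: field_simps)
qed

lemma nearly_harmonic_abs_le:
  assumes "0 < c" "0 < K" "0 < \<epsilon>"
  shows "\<exists>n0. \<forall>f d. nearly_harmonic c K f d \<longrightarrow> (\<forall>n\<ge>n0. \<bar>d n\<bar> \<le> \<epsilon>)"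
proof -
  obtain n0 where n0: "\<And>f d n. nearly_harmonic c K f d \<Longrightarrow> n0 \<le> n \<Longrightarrow> d n \<le> \<epsilon>"
    using nearly_harmonic_le[OF assms] by blast
  have "\<bar>d n\<bar> \<le> \<epsilon>" if "nearly_harmonic c K f d" "n0 \<le> n" for f d n
    using n0[OF that] n0[OF nearly_harmonic_uminus[OF that(1)] that(2)] by linarith
  then show ?thesis by blast
qed

text \<open>A quantitative Toeplitz argument: up to \<open>I\<close> the values are close to
  \<open>v\<close>; beyond \<open>I\<close> the small weight makes the crude bound \<open>K\<close>
  enough. The mass missing from \<open>p\<close> on costs the summand with
  \<open>\<bar>v\<bar>\<close>.\<close>

lemma weighted_sum_close:
  assumes g: "\<And>m. 0 \<le> g m" "g sums G" and p: "I < p"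
    and near: "\<And>m. m \<le> I \<Longrightarrow> \<bar>y m - v\<bar> \<le> \<epsilon>" and far: "\<And>m. m < p \<Longrightarrow> \<bar>y m - v\<bar> \<le> K"
    and \<epsilon>: "0 \<le> \<epsilon>" and K: "0 \<le> K"
  shows "\<bar>(\<Sum>m<p. g m * y m) - v * G\<bar> \<le> \<epsilon> * G + (K + \<bar>v\<bar>) * tail_sum g I"
proof -
  obtain p' where p': "p = Suc p'" using p by (cases p) auto
  have tp: "G = (\<Sum>m<p. g m) + tail_sum g p'" using tail_sum_eq[OF g(2), of p'] unfolding p'
    by (simp add: lessThan_Suc_atMost)
  have tn: "0 \<le> tail_sum g m" for m using g by (intro tail_sum_nonneg) (auto simp: sums_iff)
  have split: "(\<Sum>m<p. h m) = (\<Sum>m\<le>I. h m) + (\<Sum>m\<in>{Suc I..<p}. h m)" for h :: "nat \<Rightarrow> real"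
    using p by (subst sum.union_disjoint[symmetric]) (auto intro!: sum.cong)
  have "(\<Sum>m<p. g m * y m) - v * G = (\<Sum>m<p. g m * (y m - v)) - v * tail_sum g p'"
    unfolding tp by (simp add: algebra_simps sum_subtractf sum_distrib_left)
  moreover have "\<bar>\<Sum>m<p. g m * (y m - v)\<bar> \<le> (\<Sum>m<p. g m * \<bar>y m - v\<bar>)"
    using sum_abs[of "\<lambda>m. g m * (y m - v)" "{..<p}"] g by (simp add: abs_mult)
  moreover have "\<bar>v * tail_sum g p'\<bar> \<le> \<bar>v\<bar> * tail_sum g I"
  proof -
    have "tail_sum g p' \<le> tail_sum g I"
      using p p' g by (intro tail_sum_antimono) (auto simp: sums_iff)
    then show ?thesis using tn[of p'] by (simp add: abs_mult mult_left_mono)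
  qed
  moreover have "(\<Sum>m<p. g m * \<bar>y m - v\<bar>) = (\<Sum>m\<le>I. g m * \<bar>y m - v\<bar>) + (\<Sum>m\<in>{Suc I..<p}. g m * \<bar>y m - v\<bar>)"
    by (rule split)
  moreover have "(\<Sum>m\<le>I. g m * \<bar>y m - v\<bar>) \<le> \<epsilon> * G"
  proof -
    have "(\<Sum>m\<le>I. g m * \<bar>y m - v\<bar>) \<le> (\<Sum>m\<le>I. g m * \<epsilon>)"
      using g near by (intro sum_mono mult_left_mono) auto
    also have "\<dots> = \<epsilon> * (\<Sum>m\<le>I. g m)" by (simp add: sum_distrib_left mult.commute)
    also have "\<dots> \<le> \<epsilon> * G" using tail_sum_eq[OF g(2), of I] tn[of I] \<epsilon> by (intro mult_left_mono) auto
    finally show ?thesis .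
  qed
  moreover have "(\<Sum>m\<in>{Suc I..<p}. g m * \<bar>y m - v\<bar>) \<le> K * tail_sum g I"
  proof -
    have "(\<Sum>m\<in>{Suc I..<p}. g m * \<bar>y m - v\<bar>) \<le> (\<Sum>m\<in>{Suc I..<p}. g m * K)"
      using g far by (intro sum_mono mult_left_mono) auto
    also have "\<dots> = K * (tail_sum g I - tail_sum g p')"
      using tp tail_sum_eq[OF g(2), of I] split[of g] by (simp add: sum_distrib_right[symmetric])
    also have "\<dots> \<le> K * tail_sum g I" using tn[of p'] K by (intro mult_left_mono) auto
    finally show ?thesis .
  qed
  moreover have "(K + \<bar>v\<bar>) * tail_sum g I = K * tail_sum g I + \<bar>v\<bar> * tail_sum g I"
    by (simp add: distrib_right)
  ultimately show ?thesis by linarith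
qed

text \<open>
  The renewal theorem is needed uniformly in the step distribution \<open>f\<close>, because the queues vary. The
  bound \<open>c \<le> f 1\<close> is a uniform form of aperiodicity.
\<close>

definition renewal_class ::
  "real \<Rightarrow> real \<Rightarrow> (nat \<Rightarrow> real) \<Rightarrow> (nat \<Rightarrow> real) \<Rightarrow> (nat \<Rightarrow> real) \<Rightarrow> bool" where
  "renewal_class c K f b x \<longleftrightarrow>
     (\<forall>m. 0 \<le> f m) \<and> f sums 1 \<and> c \<le> f 1 \<and>
     summable (\<lambda>m. real m ^ 2 * f m) \<and> (\<Sum>m. real m ^ 2 * f m) \<le> K \<and>
     (\<forall>m. 0 \<le> b m) \<and> summable b \<and> suminf b \<le> 1 \<and>
     summable (\<lambda>m. real m * b m) \<and> (\<Sum>m. real m * b m) \<le> K \<and> renewal_eq f b x"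

context
  fixes c K :: real and f b x :: "nat \<Rightarrow> real"
  assumes cl: "renewal_class c K f b x" and c_pos: "0 < c"
begin

lemma renewal_class_facts:
  "\<And>m. 0 \<le> f m" "f sums 1" "c \<le> f 1"
  "summable (\<lambda>m. real m ^ 2 * f m)" "(\<Sum>m. real m ^ 2 * f m) \<le> K"
  "\<And>m. 0 \<le> b m" "summable b" "suminf b \<le> 1"
  "summable (\<lambda>m. real m * b m)" "(\<Sum>m. real m * b m) \<le> K" "renewal_eq f b x"
  using cl unfolding renewal_class_def by blast+

lemma renewal_class_summable: "summable f" using renewal_class_facts(2) by (simp add: sums_iff)

lemma renewal_class_atom_le: "f 0 \<le> 1 - c"
proof -
  have "f 0 + f 1 \<le> 1" using tail_sum_eq[OF renewal_class_facts(2), of 1] tail_sum_nonneg[OF renewal_class_summable renewal_class_facts(1), of 1] by simp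
  then show ?thesis using renewal_class_facts(3) by linarith
qed

lemma renewal_class_nonneg: "0 \<le> x n"
  using renewal_class_atom_le c_pos by (intro renewal_nonneg[OF renewal_class_facts(11) renewal_class_facts(1) _ renewal_class_facts(6)]) linarith

lemma renewal_class_tail_conv: "(\<Sum>m\<le>n. tail_sum f m * x (n - m)) = (\<Sum>j\<le>n. b j)"
  using renewal_tail_identity[OF renewal_class_facts(11,2), of n] by simp

text \<open>In the conservation law the term \<open>m = 0\<close> alone has weight
  \<open>1 - f 0\<close>, at least \<open>c\<close>; the others are nonnegative and the total is at
  most 1.\<close>

lemma renewal_class_le: "x n \<le> 1 / c"
proof -
  have "c * x n \<le> tail_sum f 0 * x n"
    using renewal_class_atom_le renewal_class_nonneg tail_sum_eq[OF renewal_class_facts(2), of 0] by (intro mult_right_mono) auto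
  also have "\<dots> \<le> (\<Sum>m\<le>n. tail_sum f m * x (n - m))"
    using renewal_class_nonneg tail_sum_nonneg[OF renewal_class_summable renewal_class_facts(1)]
    by (subst sum.remove[of _ 0]) (auto intro!: sum_nonneg)
  also have "\<dots> \<le> 1"
    unfolding renewal_class_tail_conv using sum_le_suminf[OF renewal_class_facts(7), of "{..n}"] renewal_class_facts(6,8) by simp
  finally show ?thesis using c_pos by (simp add: field_simps)
qed

lemma renewal_class_bound_nonneg: "0 \<le> K"
  using suminf_nonneg[OF renewal_class_facts(9)] renewal_class_facts(6,10) by (meson mult_nonneg_nonneg of_nat_0_le_iff order_trans)

lemma renewal_class_summable_mean: "summable (\<lambda>m. real m * f m)"
  using summable_lower_moment[OF renewal_class_facts(1) renewal_class_facts(4), of 1] by simp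

lemma renewal_class_mean_le: "(\<Sum>m. real m * f m) \<le> K"
proof -
  have "real m * f m \<le> real m ^ 2 * f m" for m
  proof (rule mult_right_mono[OF _ renewal_class_facts(1)])
    have "m \<le> m ^ 2" by (cases m) (auto simp: power2_eq_square)
    then show "real m \<le> real m ^ 2" by (metis of_nat_le_iff of_nat_power)
  qed
  then have "(\<Sum>m. real m * f m) \<le> (\<Sum>m. real m ^ 2 * f m)"
    by (intro suminf_le renewal_class_summable_mean renewal_class_facts(4))
  then show ?thesis using renewal_class_facts(5) by simp
qed

lemma renewal_class_forcing_moment_le: "real m * b m \<le> K"
proof -
  have "real m * b m \<le> (\<Sum>m. real m * b m)"
    using sum_le_suminf[OF renewal_class_facts(9), of "{m}"] renewal_class_facts(6) by simp
  then show ?thesis using renewal_class_facts(10) by simp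
qed

lemma renewal_class_forcing_le_1: "b m \<le> 1"
  using sum_le_suminf[OF renewal_class_facts(7), of "{m}"] renewal_class_facts(6,8) by simp

text \<open>In the constant, \<open>1 / c\<close> bounds the values and telescoped sums of
  \<open>x\<close>, \<open>K\<close> bounds the moments, and 1 pays for the index shift in
  \<open>n * b (n - 1)\<close>.\<close>

lemma nearly_harmonic_increment: "nearly_harmonic c (K + 1 + 1 / c) f (increment x)"
  unfolding nearly_harmonic_def
proof (intro conjI allI)
  have c1: "0 < 1 / c" using c_pos by simp
  show "0 \<le> f m" "f sums 1" "c \<le> f 1" for m by (fact renewal_class_facts)+
  show "real (Suc m) * tail_sum f m \<le> K + 1 + 1 / c" for m
    using index_mult_tail_sum_le[OF renewal_class_summable renewal_class_facts(1) summable_sums[OF renewal_class_summable_mean], of m] renewal_class_mean_le c1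
    by linarith
  show "\<bar>increment x n\<bar> \<le> K + 1 + 1 / c" for n
    using renewal_class_le[of n] renewal_class_nonneg[of n] renewal_class_le[of "n - 1"]
      renewal_class_nonneg[of "n - 1"] renewal_class_bound_nonneg by (auto simp: increment_def)
  show "real n * \<bar>increment x n - (\<Sum>m\<le>n. f m * increment x (n - m))\<bar> \<le> K + 1 + 1 / c" for n
  proof (cases n)
    case 0
    then show ?thesis using renewal_class_bound_nonneg c1 by simp
  next
    case (Suc k)
    have "real n * \<bar>increment x n - (\<Sum>m\<le>n. f m * increment x (n - m))\<bar> = \<bar>real n * b n - (real k * b k + b k)\<bar>"
    proof -
      have "real n * \<bar>y\<bar> = \<bar>real n * y\<bar>" for y by (simp add: abs_mult)
      moreover have "increment x n - (\<Sum>m\<le>n. f m * increment x (n - m)) = b n - b k" 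
        using renewal_eq_increment[OF renewal_class_facts(11)] unfolding renewal_eq_def Suc by (metis add_diff_cancel_right' increment_simps(2))
      moreover have "real n * (b n - b k) = real n * b n - (real k * b k + b k)"
        unfolding Suc by (simp add: algebra_simps)
      ultimately show ?thesis by metis
    qed
    also have "\<dots> \<le> K + 1"
      using renewal_class_forcing_moment_le[of n] renewal_class_forcing_moment_le[of k] renewal_class_forcing_le_1[of k] renewal_class_facts(6)[of n] renewal_class_facts(6)[of k] renewal_class_bound_nonneg
      by (smt (verit) mult_nonneg_nonneg of_nat_0_le_iff)
    finally show ?thesis using c1 by linarith
  qed
  show "\<bar>\<Sum>i<p. increment x (n + i)\<bar> \<le> K + 1 + 1 / c" for n p
  proof -
    have tot: "(\<Sum>i<q. increment x i) = (if q = 0 then 0 else x (q - 1))" for q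
      using sum_increment by (cases q) (auto simp: lessThan_Suc_atMost)
    have "(\<Sum>i<n+p. increment x i) = (\<Sum>i<n. increment x i) + (\<Sum>i<p. increment x (n + i))"
      by (induction p) auto
    then have "\<bar>\<Sum>i<p. increment x (n + i)\<bar> \<le> 1 / c"
      unfolding tot using renewal_class_le renewal_class_nonneg c1
      by (smt (verit))
    then show ?thesis using renewal_class_bound_nonneg by linarith
  qed
qed

text \<open>Small increments make \<open>x\<close> almost constant on the window of length
  \<open>I\<close> before \<open>n\<close>, so the conservation law reads \<open>x n\<close> times
  the mass of the tails, which is the mean of \<open>f\<close>. The three errors come from the
  window, from the tails beyond it, and from cutting off \<open>b\<close> at
  \<open>n\<close>.\<close>

lemma renewal_class_close:
  assumes dx: "\<And>j. n0 \<le> j \<Longrightarrow> \<bar>increment x j\<bar> \<le> \<epsilon>" and n: "n0 + I < n" and "0 \<le> \<epsilon>"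
  shows "\<bar>x n * (\<Sum>m. real m * f m) - suminf b\<bar> \<le> real I * \<epsilon> * K + (2 / c) * (K / Suc I) + K / n"
proof -
  note fm = renewal_class_summable renewal_class_facts(1)
  have c1: "0 < 1 / c" using c_pos by simp
  have q: "tail_sum f sums (\<Sum>m. real m * f m)" (is "_ sums ?G")
    using tail_sum_sums[OF fm summable_sums[OF renewal_class_summable_mean]] .
  have qn: "\<And>m. 0 \<le> tail_sum f m" using tail_sum_nonneg[OF fm] .
  have near: "\<bar>x (n - m) - x n\<bar> \<le> real m * \<epsilon>" if "m \<le> I" for m
    using that
  proof (induction m)
    case (Suc m)
    have "\<bar>increment x (n - m)\<bar> \<le> \<epsilon>" using Suc n by (intro dx) auto
    moreover have "increment x (n - m) = x (n - m) - x (n - Suc m)" using Suc n by (auto simp: increment_def)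
    ultimately show ?case using Suc by (simp add: algebra_simps abs_if split: if_splits)
  qed simp
  have near': "\<bar>x (n - m) - x n\<bar> \<le> real I * \<epsilon>" if "m \<le> I" for m
    using near[OF that] that assms(3) by (meson mult_right_mono of_nat_le_iff order_trans)
  have far: "\<bar>x (n - m) - x n\<bar> \<le> 1 / c" for m
    using renewal_class_le[of n] renewal_class_nonneg[of n] renewal_class_le[of "n - m"]
      renewal_class_nonneg[of "n - m"] by linarith
  have "\<bar>(\<Sum>m<Suc n. tail_sum f m * x (n - m)) - x n * ?G\<bar>
      \<le> (real I * \<epsilon>) * ?G + (1 / c + \<bar>x n\<bar>) * tail_sum (tail_sum f) I"
    using n assms(3) c1 by (intro weighted_sum_close qn q near' far) auto
  also have "(real I * \<epsilon>) * ?G \<le> real I * \<epsilon> * K"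
    using assms(3) renewal_class_mean_le by (intro mult_left_mono) auto
  also have "(1 / c + \<bar>x n\<bar>) * tail_sum (tail_sum f) I \<le> (2 / c) * (K / Suc I)"
  proof (rule mult_mono)
    show "1 / c + \<bar>x n\<bar> \<le> 2 / c" using renewal_class_le[of n] renewal_class_nonneg[of n] by simp
    show "tail_sum (tail_sum f) I \<le> K / Suc I"
    proof -
      have ch: "real (m choose 2) * f m \<le> real m ^ 2 * f m" for m
      proof (rule mult_right_mono)
        show "real (m choose 2) \<le> (real m)\<^sup>2"
          using binomial_le_pow[of 2 m] by (cases "m < 2") (auto simp: binomial_eq_0 simp flip: of_nat_power)
      qed (rule renewal_class_facts(1))
      have s2: "summable (\<lambda>m. real (m choose 2) * f m)"
        by (rule summable_comparison_test'[OF renewal_class_facts(4), of 0]) (use ch renewal_class_facts(1) in auto)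
      \<comment> \<open>The mean of the tails is the second binomial moment of \<open>f\<close>, so
        Markov's inequality applies to the tails themselves.\<close>
      have "(\<lambda>m. real m * tail_sum f m) sums (\<Sum>m. real (m choose 2) * f m)"
        using tail_sum_moments[OF fm, of 1 "\<Sum>m. real (m choose 2) * f m"] summable_sums[OF s2] by (simp add: numeral_2_eq_2)
      from index_mult_tail_sum_le[OF _ qn this, of I]
      have "real (Suc I) * tail_sum (tail_sum f) I \<le> (\<Sum>m. real (m choose 2) * f m)"
        using sums_summable[OF q] by simp
      also have "\<dots> \<le> K" using suminf_le[OF ch s2 renewal_class_facts(4)] renewal_class_facts(5) by simp
      finally show ?thesis by (simp add: field_simps)
    qed
    show "0 \<le> 2 / c" using c1 by simp
    show "0 \<le> tail_sum (tail_sum f) I" using sums_summable[OF q] qn by (rule tail_sum_nonneg)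
  qed
  also have "(\<Sum>m<Suc n. tail_sum f m * x (n - m)) = (\<Sum>j\<le>n. b j)"
    using renewal_class_tail_conv by (simp add: lessThan_Suc_atMost)
  finally have 1: "\<bar>(\<Sum>j\<le>n. b j) - x n * ?G\<bar> \<le> real I * \<epsilon> * K + (2 / c) * (K / Suc I)" by simp
  have "real (Suc n) * tail_sum b n \<le> K"
    using index_mult_tail_sum_le[OF renewal_class_facts(7,6) summable_sums[OF renewal_class_facts(9)], of n] renewal_class_facts(10) by simp
  then have "real n * tail_sum b n \<le> K" using tail_sum_nonneg[OF renewal_class_facts(7,6), of n] by (simp add: algebra_simps)
  then have "\<bar>suminf b - (\<Sum>j\<le>n. b j)\<bar> \<le> K / n"
    using tail_sum_eq[OF summable_sums[OF renewal_class_facts(7)], of n] tail_sum_nonneg[OF renewal_class_facts(7,6), of n] n by (simp add: field_simps)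
  with 1 show ?thesis by linarith
qed

end

text \<open>The order of the choices matters: \<open>I\<close> is fixed by the tail error, the
  tolerance for the increments is then taken small relative to \<open>I\<close>, and only after that
  is the index bound chosen.\<close>

lemma uniform_renewal:
  assumes c: "0 < c" and \<epsilon>: "0 < \<epsilon>"
  shows "\<exists>n0. \<forall>f b x. renewal_class c K f b x \<longrightarrow>
    (\<forall>n\<ge>n0. \<bar>x n * (\<Sum>m. real m * f m) - suminf b\<bar> \<le> \<epsilon>)"
\<comment> \<open>\<open>K\<close> bounds sums of nonnegative terms, so the class is empty for
  negative \<open>K\<close>.\<close>
proof (cases "0 \<le> K")
  case False
  then show ?thesis using renewal_class_bound_nonneg[OF _ c] by blast
next
  case K: True
  obtain I :: nat where I: "(2 / c) * K * 3 / \<epsilon> < real I" using reals_Archimedean2 by blast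
  define \<epsilon>' where "\<epsilon>' = \<epsilon> / (3 * (real I * K + 1))"
  have \<epsilon>': "0 < \<epsilon>'" unfolding \<epsilon>'_def using \<epsilon> K by (simp add: add_nonneg_pos)
  have "0 < K + 1 + 1 / c" using c K by (simp add: add_nonneg_pos)
  from nearly_harmonic_abs_le[OF c this \<epsilon>'] obtain n1 where
    n1: "\<And>f d n. nearly_harmonic c (K + 1 + 1 / c) f d \<Longrightarrow> n1 \<le> n \<Longrightarrow> \<bar>d n\<bar> \<le> \<epsilon>'" by blast
  obtain J :: nat where J: "3 * K / \<epsilon> < real J" using reals_Archimedean2 by blast
  have "\<bar>x n * (\<Sum>m. real m * f m) - suminf b\<bar> \<le> \<epsilon>"
    if cl: "renewal_class c K f b x" and n: "Suc (n1 + I + J) \<le> n" for f b x n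
  proof -
    have "\<bar>x n * (\<Sum>m. real m * f m) - suminf b\<bar> \<le> real I * \<epsilon>' * K + (2 / c) * (K / Suc I) + K / n"
      using n \<epsilon>' by (intro renewal_class_close[OF cl c, of n1] n1[OF nearly_harmonic_increment[OF cl c]]) auto
    also have "real I * \<epsilon>' * K \<le> \<epsilon> / 3"
    proof -
      have "real I * \<epsilon>' * K = (\<epsilon> / 3) * ((real I * K) / (real I * K + 1))"
        unfolding \<epsilon>'_def by simp
      also have "\<dots> \<le> (\<epsilon> / 3) * 1"
        using \<epsilon> K by (intro mult_left_mono) (auto simp: divide_le_eq add_nonneg_pos)
      finally show ?thesis by simp
    qed
    also have "(2 / c) * (K / Suc I) \<le> \<epsilon> / 3"
    proof -
      have "(2 / c) * K * 3 / \<epsilon> \<le> real (Suc I)" using I by simp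
      then have "(2 / c) * K * 3 \<le> real (Suc I) * \<epsilon>" using \<epsilon> by (subst (asm) pos_divide_le_eq)
      then have "(2 / c) * K \<le> real (Suc I) * \<epsilon> / 3" by linarith
      then have "(2 / c) * K \<le> \<epsilon> / 3 * real (Suc I)" by (simp only: mult_ac times_divide_eq_right)
      then have "(2 / c) * K / real (Suc I) \<le> \<epsilon> / 3" by (subst pos_divide_le_eq) auto
      then show ?thesis by simp
    qed
    also have "K / n \<le> \<epsilon> / 3"
    proof -
      have "3 * K / \<epsilon> \<le> real n" using J n by simp
      then show ?thesis using \<epsilon> n by (simp add: field_simps)
    qed
    finally show ?thesis by simp
  qed
  then show ?thesis by blast
qed

subsection \<open>Arrivals during a service time\<close>

lemma power_le_fact_exp:
  fixes y :: real
  assumes "0 \<le> y"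
  shows "exp (- y) * y ^ i \<le> fact i"
proof -
  have "y ^ i / fact i \<le> exp y"
    using sum_le_suminf[OF summable_exp_generic[of y], of "{i}"] assms
    by (simp add: exp_def divide_inverse mult.commute)
  then have "exp (- y) * (y ^ i / fact i) \<le> exp (- y) * exp y"
    by (intro mult_left_mono) auto
  then show ?thesis by (simp add: exp_minus_inverse divide_le_eq mult.commute)
qed

text \<open>After a shift by \<open>r\<close> the binomial coefficient cancels against the factorial
  and the exponential series remains.\<close>

lemma poisson_factorial_moment:
  fixes y :: real
  shows "(\<lambda>i. real (i choose r) * (exp (- y) * y ^ i / fact i)) sums (y ^ r / fact r)"
proof -
  have "(\<lambda>i. y ^ i /\<^sub>R fact i) sums exp y"
    by (rule exp_converges)
  then have "(\<lambda>i. (exp (- y) * y ^ r / fact r) * (y ^ i /\<^sub>R fact i)) sums ((exp (- y) * y ^ r / fact r) * exp y)"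
    by (rule sums_mult)
  also have "(exp (- y) * y ^ r / fact r) * exp y = y ^ r / fact r"
    by (simp add: exp_minus field_simps)
  also have "(\<lambda>i. (exp (- y) * y ^ r / fact r) * (y ^ i /\<^sub>R fact i))
      = (\<lambda>i. real (i + r choose r) * (exp (- y) * y ^ (i + r) / fact (i + r)))"
  proof
    fix i
    have "real (i + r choose r) = fact (i + r) / (fact r * fact i)"
      by (subst binomial_fact) auto
    then show "(exp (- y) * y ^ r / fact r) * (y ^ i /\<^sub>R fact i)
      = real (i + r choose r) * (exp (- y) * y ^ (i + r) / fact (i + r))"
      by (simp add: power_add field_simps)
  qed
  \<comment> \<open>Shifting back adds only indices below \<open>r\<close>, where
    \<open>i choose r\<close> vanishes.\<close>
  finally show ?thesis
    by (subst (asm) sums_iff_shift) (simp add: binomial_eq_0)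
qed

context
  fixes B :: "real measure" and l :: real
  assumes dist: "real_distribution B" and nn: "AE x in B. 0 \<le> x" and l: "0 < l"
begin

interpretation real_distribution B by (rule dist)

lemma integrable_arrivals: "integrable B (\<lambda>x. exp (- l * x) * (l * x) ^ i / fact i)"
proof (rule integrable_const_bound[where B = 1])
  show "AE x in B. norm (exp (- l * x) * (l * x) ^ i / fact i) \<le> 1"
    using nn
  proof eventually_elim
    case (elim x)
    then show ?case using power_le_fact_exp[of "l * x" i] l by (simp add: abs_mult divide_le_eq)
  qed
qed simp

lemma arrivals_prob_nonneg: "0 \<le> arrivals_prob l B i"
  unfolding arrivals_prob_def using nn l by (intro integral_nonneg_AE) (auto elim!: eventually_mono)

text \<open>The number of arrivals is mixed Poisson with parameter \<open>l * x\<close>. Series and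
  integral may be exchanged because the terms are nonnegative almost everywhere and their partial
  sums stay below an integrable function.\<close>

lemma arrivals_factorial_moment:
  assumes int: "integrable B (\<lambda>x. (l * x) ^ r)"
  shows "(\<lambda>i. real (i choose r) * arrivals_prob l B i) sums (rho_moment l B r / fact r)"
proof -
  define F where "F i x = real (i choose r) * (exp (- l * x) * (l * x) ^ i / fact i)" for i x
  have s: "(\<lambda>i. F i x) sums ((l * x) ^ r / fact r)" for x
    unfolding F_def using poisson_factorial_moment[of r "l * x"] by simp
  have Fi: "integrable B (F i)" for i
    unfolding F_def by (intro integrable_mult_right integrable_arrivals)
  have F_nn: "AE x in B. \<forall>i. 0 \<le> F i x"
    using nn by eventually_elim (use l in \<open>auto simp: F_def\<close>)
  have eq: "(LINT x|B. norm (F i x)) = (LINT x|B. F i x)" for i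
    using F_nn Fi by (intro integral_cong_AE) (auto elim!: eventually_mono)
  have "(\<Sum>i<n. LINT x|B. F i x) \<le> (LINT x|B. (l * x) ^ r / fact r)" for n
  proof -
    have "(\<Sum>i<n. LINT x|B. F i x) = (LINT x|B. (\<Sum>i<n. F i x))" using Fi by simp
    also have "\<dots> \<le> (LINT x|B. (l * x) ^ r / fact r)"
    proof (rule integral_mono_AE)
      show "AE x in B. (\<Sum>i<n. F i x) \<le> (l * x) ^ r / fact r"
        using F_nn
      proof eventually_elim
        case (elim x)
        then show ?case
          using sum_le_suminf[OF sums_summable[OF s[of x]], of "{..<n}"] sums_unique[OF s[of x]] by simp
      qed
    qed (use Fi int in auto)
    finally show ?thesis .
  qed
  then have "summable (\<lambda>i. LINT x|B. norm (F i x))"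
    unfolding eq using F_nn
    by (intro summableI_nonneg_bounded integral_nonneg_AE) (auto elim!: eventually_mono)
  moreover have "AE x in B. summable (\<lambda>i. norm (F i x))"
    using F_nn
  proof eventually_elim
    case (elim x)
    then show ?case using sums_summable[OF s[of x]] by simp
  qed
  ultimately have "(\<lambda>i. LINT x|B. F i x) sums (LINT x|B. (\<Sum>i. F i x))"
    by (intro sums_integral Fi)
  moreover have "(LINT x|B. F i x) = real (i choose r) * arrivals_prob l B i" for i
    unfolding F_def arrivals_prob_def using integrable_arrivals by simp
  moreover have "(LINT x|B. (\<Sum>i. F i x)) = rho_moment l B r / fact r"
    unfolding rho_moment_def by (simp add: s[THEN sums_unique, symmetric])
  ultimately show ?thesis by simp
qed

end

subsection \<open>Busy periods as a renewal sequence\<close>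

text \<open>The second-order companion of Bernoulli's inequality. The coefficient 1 of the quadratic
  term lets \<open>(Suc m)^2\<close> absorb \<open>m + m^2\<close> in the induction.\<close>

lemma power_one_minus_le:
  fixes \<eta> :: real
  assumes "0 \<le> \<eta>" "\<eta> \<le> 1"
  shows "(1 - \<eta>) ^ m \<le> 1 - real m * \<eta> + real m ^ 2 * \<eta> ^ 2"
proof (induction m)
  case (Suc m)
  have "(1 - \<eta>) ^ Suc m \<le> (1 - \<eta>) * (1 - real m * \<eta> + real m ^ 2 * \<eta> ^ 2)"
    using Suc assms by (simp add: mult_left_mono)
  also have "\<dots> = 1 - real (Suc m) * \<eta> + (real m + real m ^ 2) * \<eta> ^ 2 - real m ^ 2 * \<eta> ^ 3"
    by (simp add: algebra_simps power2_eq_square power3_eq_cube)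
  also have "\<dots> \<le> 1 - real (Suc m) * \<eta> + (real m + real m ^ 2) * \<eta> ^ 2"
    using assms by simp
  also have "(real m + real m ^ 2) * \<eta> ^ 2 \<le> real (Suc m) ^ 2 * \<eta> ^ 2"
    by (intro mult_right_mono) (auto simp: power2_eq_square algebra_simps)
  finally show ?case by simp
qed simp

lemma infsum_atLeast_eq_suminf:
  fixes a :: "nat \<Rightarrow> real"
  assumes "summable a" "\<And>i. 0 \<le> a i"
  shows "(\<Sum>\<^sub>\<infinity>i\<in>{p..}. a i) = (\<Sum>i. a (i + p))"
proof -
  have "((\<lambda>i. a (i + p)) has_sum (\<Sum>i. a (i + p))) UNIV"
    using assms by (intro norm_summable_imp_has_sum) (auto simp: summable_sums summable_iff_shift)
  moreover have "bij_betw (\<lambda>i. i + p) UNIV {p..}"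
    by (rule bij_betwI[where g = "\<lambda>i. i - p"]) auto
  ultimately have "(a has_sum (\<Sum>i. a (i + p))) {p..}"
    using has_sum_reindex_bij_betw[of "\<lambda>i. i + p" UNIV "{p..}" a] by simp
  then show ?thesis by (rule infsumI)
qed

section \<open>A single queue: moments of the arrival counts and of their tails\<close>

locale supercritical_queue =
  fixes l \<mu> \<delta> :: real and B :: "real measure"
  assumes l: "0 < l" and serv: "service_distribution B \<mu>" and load: "l / \<mu> = 1 + \<delta>" and \<delta>: "0 < \<delta>"
    and third: "integrable B (\<lambda>x. (l * x) ^ 3)"
begin

abbreviation "a \<equiv> arrivals_prob l B"
abbreviation "\<rho>\<^sub>2 \<equiv> rho_moment l B 2"
abbreviation "\<rho>\<^sub>3 \<equiv> rho_moment l B 3"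

definition "f = tail_sum a"
text \<open>The factor \<open>\<mu>\<close> normalizes to \<open>W 0 = 1\<close>, so that the
  forcing term of the renewal equation consists of plain sums of \<open>a\<close>.\<close>

definition "W n = \<mu> * mean_busy l \<mu> B n"
definition "D = increment W"

lemma dist: "real_distribution B" and nonneg: "AE x in B. 0 \<le> x" and \<mu>: "0 < \<mu>"
  and mean: "(LINT x|B. x) = 1 / \<mu>"
  using serv unfolding service_distribution_def by auto

interpretation real_distribution B by (rule dist)

lemma integrable_moment: "q \<le> 3 \<Longrightarrow> integrable B (\<lambda>x. (l * x) ^ q)"
proof (rule Bochner_Integration.integrable_bound[where f = "\<lambda>x. 1 + (l * x) ^ 3"])
  assume q: "q \<le> 3"
  show "AE x in B. norm ((l * x) ^ q) \<le> norm (1 + (l * x) ^ 3)"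
    using nonneg
  proof eventually_elim
    case (elim x)
    then have y: "0 \<le> l * x" using l by simp
    have "(l * x) ^ q \<le> 1 + (l * x) ^ 3"
    proof (cases "l * x \<le> 1")
      case True
      have "0 \<le> (l * x) ^ 3" by (rule zero_le_power[OF y])
      then show ?thesis using power_le_one[OF y True, of q] by linarith
    next
      case False
      then show ?thesis using power_increasing[OF q, of "l * x"] by linarith
    qed
    then show ?case using zero_le_power[OF y, of q] zero_le_power[OF y, of 3] by (simp only: real_norm_def)
  qed
qed (use third in auto)

lemma measure_UNIV: "measure B UNIV = 1"
  using prob_space by simp

lemma moment_0: "rho_moment l B 0 = 1" and moment_1: "rho_moment l B 1 = 1 + \<delta>"
  using load mean by (simp_all add: rho_moment_def measure_UNIV)

text \<open>Expand the square of \<open>l * x - 1\<close>, where the mean of \<open>l * x\<close>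
  exceeds 1. The bound keeps every division by the second moment uniform in the queue.\<close>

lemma \<rho>2_ge: "1 \<le> \<rho>\<^sub>2"
proof -
  have "0 \<le> (LINT x|B. (l * x - 1) ^ 2)" by simp
  also have "\<dots> = (LINT x|B. (l * x) ^ 2 - 2 * (l * x) ^ 1 + (l * x) ^ 0)"
    by (intro Bochner_Integration.integral_cong refl) (simp add: power2_eq_square algebra_simps)
  also have "\<dots> = \<rho>\<^sub>2 - 2 * rho_moment l B 1 + rho_moment l B 0"
    unfolding rho_moment_def
    using integrable_moment[of 2] integrable_moment[of 1] integrable_moment[of 0]
    by (simp del: power_one_right power_0)
  finally show ?thesis using moment_0 moment_1 \<delta> by simp
qed

lemma a_nonneg: "0 \<le> a i"
  by (rule arrivals_prob_nonneg[OF dist nonneg l])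

lemma a_moment: "r \<le> 3 \<Longrightarrow> (\<lambda>i. real (i choose r) * a i) sums (rho_moment l B r / fact r)"
  by (rule arrivals_factorial_moment[OF dist nonneg l integrable_moment])

lemma a_sums: "a sums 1"
  using a_moment[of 0] moment_0 by simp

lemma a_summable: "summable a"
  using a_sums by (rule sums_summable)

lemma a_mean: "(\<lambda>i. real i * a i) sums (1 + \<delta>)"
  using a_moment[of 1] moment_1 by simp

lemma a0_eq: "a 0 = laplace_stieltjes B l"
  by (simp add: arrivals_prob_def laplace_stieltjes_def)

text \<open>Jensen's inequality, through the tangent of \<open>exp (- t)\<close> at the mean
  \<open>t = 1 + \<delta>\<close>.\<close>

lemma a0_ge: "exp (- (1 + \<delta>)) \<le> a 0"
proof -
  have "exp (- (1 + \<delta>)) = (LINT x|B. exp (- (1 + \<delta>)) * (1 + ((1 + \<delta>) - l * x)))"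
    using integrable_moment[of 1] moment_1 by (simp add: rho_moment_def measure_UNIV)
  also have "\<dots> \<le> (LINT x|B. exp (- l * x))"
  proof (rule integral_mono)
    show "integrable B (\<lambda>x. exp (- l * x))" using integrable_arrivals[OF dist nonneg l, of 0] by simp
    show "exp (- (1 + \<delta>)) * (1 + ((1 + \<delta>) - l * x)) \<le> exp (- l * x)" for x
    proof -
      have "exp (- (1 + \<delta>)) * (1 + ((1 + \<delta>) - l * x)) \<le> exp (- (1 + \<delta>)) * exp ((1 + \<delta>) - l * x)"
        by (intro mult_left_mono exp_ge_add_one_self) auto
      also have "\<dots> = exp (- l * x)" by (simp flip: exp_add)
      finally show ?thesis .
    qed
  qed (use integrable_moment[of 1] in simp)
  finally show ?thesis by (simp add: arrivals_prob_def)
qed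

lemma a0_pos: "0 < a 0"
  using a0_ge exp_gt_zero by (rule order.strict_trans2[rotated])

lemma f_nonneg: "0 \<le> f m"
  unfolding f_def by (rule tail_sum_nonneg[OF a_summable a_nonneg])

lemma f_antimono: "m \<le> n \<Longrightarrow> f n \<le> f m"
  unfolding f_def by (rule tail_sum_antimono[OF a_summable a_nonneg])

lemma f_eq: "f m = 1 - (\<Sum>i\<le>m. a i)"
  unfolding f_def by (rule tail_sum_eq[OF a_sums])

lemma f_sums: "f sums (1 + \<delta>)"
  unfolding f_def by (rule tail_sum_sums[OF a_summable a_nonneg a_mean])

lemma f_summable: "summable f"
  using f_sums by (rule sums_summable)

lemma f_mean: "(\<lambda>m. real m * f m) sums (\<rho>\<^sub>2 / 2)"
  unfolding f_def using tail_sum_moments[OF a_summable a_nonneg, of 1] a_moment[of 2]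
  by (simp add: numeral_2_eq_2)

lemma f_choose_2: "(\<lambda>m. real (m choose 2) * f m) sums (\<rho>\<^sub>3 / 6)"
  unfolding f_def using tail_sum_moments[OF a_summable a_nonneg, of 2] a_moment[of 3]
  by (simp add: numeral_3_eq_3 numeral_2_eq_2)

lemma f_second_moment: "(\<lambda>m. real m ^ 2 * f m) sums (\<rho>\<^sub>2 / 2 + \<rho>\<^sub>3 / 3)"
proof -
  have "real m + 2 * real (m choose 2) = real m ^ 2" for m
  proof -
    have "2 * (m choose 2) = m * (m - 1)"
      unfolding choose_two by (rule dvd_mult_div_cancel) (cases m; simp)
    then have "m + 2 * (m choose 2) = m ^ 2" by (cases m) (auto simp: power2_eq_square)
    then show ?thesis by (metis of_nat_add of_nat_mult of_nat_numeral of_nat_power)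
  qed
  then have "real m ^ 2 * f m = real m * f m + 2 * (real (m choose 2) * f m)" for m
    by (metis distrib_right mult.assoc)
  then show ?thesis using sums_add[OF f_mean sums_mult[OF f_choose_2, of 2]] by simp
qed

lemma \<rho>3_nonneg: "0 \<le> \<rho>\<^sub>3"
  using sums_le[OF _ sums_zero f_choose_2] f_nonneg by simp

lemma f0_eq: "f 0 = 1 - a 0"
  using f_eq[of 0] by simp

definition "Q = tail_sum f"

lemma Q_nonneg: "0 \<le> Q m"
  unfolding Q_def by (rule tail_sum_nonneg[OF f_summable f_nonneg])

lemma Q_sums: "Q sums (\<rho>\<^sub>2 / 2)"
  unfolding Q_def by (rule tail_sum_sums[OF f_summable f_nonneg f_mean])

lemma Q_mean: "(\<lambda>m. real m * Q m) sums (\<rho>\<^sub>3 / 6)"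
  unfolding Q_def using tail_sum_moments[OF f_summable f_nonneg, of 1] f_choose_2
  by (simp add: numeral_2_eq_2)

text \<open>The mass at indices 1 to \<open>M\<close> is at least \<open>a 0\<close> minus the tail
  \<open>Q M\<close>, and by monotonicity it is at most \<open>M\<close> times
  \<open>f 1\<close>.\<close>

lemma f1_ge: "a 0 - \<rho>\<^sub>2 / 2 / real (Suc M) \<le> real M * f 1"
proof -
  have "(\<Sum>m\<le>M. f m) = f 0 + (\<Sum>m=1..M. f m)" by (simp add: atMost_atLeast0 sum.atLeast_Suc_atMost)
  moreover have "(\<Sum>m=1..M. f m) \<le> (\<Sum>m=1..M. f 1)" by (intro sum_mono f_antimono) auto
  moreover have "Q M = (1 + \<delta>) - (\<Sum>m\<le>M. f m)" unfolding Q_def by (rule tail_sum_eq[OF f_sums])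
  moreover have "Q M \<le> \<rho>\<^sub>2 / 2 / real (Suc M)"
    using index_mult_tail_sum_le[OF f_summable f_nonneg f_mean, of M] unfolding Q_def
    by (simp add: field_simps)
  ultimately show ?thesis using f0_eq \<delta> by simp
qed

section \<open>The renewal equation of the busy periods and the loss quantities as
  convolutions\<close>

lemma W_0: "W 0 = 1"
  using \<mu> by (simp add: W_def)

lemma W_rec: "W n = (\<Sum>j\<le>n. a j * W (Suc n - j))"
proof -
  have "W n = (\<Sum>j=0..n. W (n - j + 1) * a j)"
    unfolding W_def by (subst mean_busy_recurrence[OF dist nonneg l]) (simp add: sum_distrib_left mult_ac)
  also have "\<dots> = (\<Sum>j\<le>n. a j * W (Suc n - j))"
    by (auto simp: atMost_atLeast0 Suc_diff_le mult.commute intro!: sum.cong)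
  finally show ?thesis .
qed

text \<open>Summation by parts: as \<open>f (Suc m) = f m - a (Suc m)\<close>, the difference of
  this equation at \<open>Suc n\<close> and \<open>n\<close> is the recurrence of the busy
  periods.\<close>

lemma W_renewal: "renewal_eq f (\<lambda>n. \<Sum>j\<le>n. a j) W"
  unfolding renewal_eq_def
proof
  fix n
  show "W n = (\<Sum>j\<le>n. a j) + (\<Sum>m\<le>n. f m * W (n - m))"
  proof (induction n)
    case 0
    show ?case by (simp add: f0_eq W_0)
  next
    case (Suc n)
    have "f (Suc m) = f m - a (Suc m)" for m by (simp add: f_eq)
    then have "(\<Sum>m\<le>Suc n. f m * W (Suc n - m))
        = f 0 * W (Suc n) + (\<Sum>m\<le>n. f m * W (n - m)) - (\<Sum>m\<le>n. a (Suc m) * W (n - m))"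
      by (subst sum.atMost_Suc_shift) (simp add: sum_subtractf left_diff_distrib)
    moreover have "(\<Sum>j\<le>Suc n. a j * W (Suc n - j)) = a 0 * W (Suc n) + (\<Sum>m\<le>n. a (Suc m) * W (n - m))"
      by (subst sum.atMost_Suc_shift) simp
    moreover have "(\<Sum>j\<le>Suc n. a j * W (Suc n - j)) = W n + a (Suc n)"
      using W_rec[of n] W_0 by simp
    ultimately show ?case using Suc f0_eq by (simp add: algebra_simps)
  qed
qed

lemma D_renewal: "renewal_eq f a D"
proof -
  have "increment (\<lambda>n. \<Sum>j\<le>n. a j) = a"
  proof
    show "increment (\<lambda>n. \<Sum>j\<le>n. a j) n = a n" for n by (cases n) auto
  qed
  then show ?thesis using renewal_eq_increment[OF W_renewal] by (simp add: D_def)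
qed

lemma D_nonneg: "0 \<le> D n"
  using a0_pos f0_eq by (intro renewal_nonneg[OF D_renewal f_nonneg _ a_nonneg]) simp

lemma D_0: "D 0 = 1"
  by (simp add: D_def W_0)

text \<open>
  The excess \<open>\<delta>\<close> of the total mass of \<open>f\<close> over 1 makes \<open>\<delta> * W n\<close> appear in the tail identity for
  \<open>D\<close>. So the mean losses are again a convolution with \<open>D\<close>, and need no separate asymptotics.
\<close>

lemma mean_losses_eq:
  assumes "1 \<le> n"
  shows "mean_losses l \<mu> B n = Q (n - 1) + (\<Sum>m<n. Q m * D (n - m))"
proof -
  have "l - \<mu> = \<delta> * \<mu>" using load \<mu> by (simp add: field_simps)
  then have "mean_losses l \<mu> B n = 1 + \<delta> * W n"
    by (simp add: mean_losses_def W_def)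
  moreover have "(\<Sum>m\<le>n. Q m * D (n - m)) = (\<Sum>j\<le>n. a j) + \<delta> * W n"
    using renewal_tail_identity[OF D_renewal f_sums, of n] sum_increment[of W n]
    by (simp add: Q_def D_def)
  moreover have "(\<Sum>j\<le>n. a j) = 1 - f n" by (simp add: f_eq)
  \<comment> \<open>Splitting off the term with \<open>D 0 = 1\<close> leaves the range
    \<open>m < n\<close>, the same as in the sums of \<open>consec_coeff\<close>.\<close>
  moreover have "(\<Sum>m\<le>n. Q m * D (n - m)) = (\<Sum>m<n. Q m * D (n - m)) + Q n"
    by (simp add: lessThan_Suc_atMost[symmetric] D_0)
  moreover have "Q (n - 1) = f n + Q n"
    using tail_sum_step[OF f_summable, of "n - 1"] assms by (simp add: Q_def)
  ultimately show ?thesis by simp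
qed

lemma infsum_arrivals: "(\<Sum>\<^sub>\<infinity>i\<in>{m + 1..}. a i) = f m"
  using infsum_atLeast_eq_suminf[OF a_summable a_nonneg, of "m + 1"] by (simp add: f_def tail_sum_def)

lemma consec_coeff_eq:
  "consec_coeff l \<mu> B n k = (\<Sum>m<n. f (m + k) * D (n - m)) / (\<Sum>m<n. f (m + 1) * D (n - m))"
proof -
  have *: "\<mu> * (\<Sum>j=1..n. (mean_busy l \<mu> B j - mean_busy l \<mu> B (j - 1)) *
        (\<Sum>\<^sub>\<infinity>i\<in>{n - j + r + 1..}. a i)) = (\<Sum>m<n. f (m + r) * D (n - m))" for r
  proof -
    have "\<mu> * (\<Sum>j=1..n. (mean_busy l \<mu> B j - mean_busy l \<mu> B (j - 1)) *
        (\<Sum>\<^sub>\<infinity>i\<in>{n - j + r + 1..}. a i)) = (\<Sum>j=1..n. D j * f (n - j + r))"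
      unfolding infsum_arrivals sum_distrib_left
      by (intro sum.cong) (auto simp: D_def increment_def W_def algebra_simps)
    also have "\<dots> = (\<Sum>m<n. f (m + r) * D (n - m))"
      by (rule sum.reindex_bij_witness[of _ "\<lambda>m. n - m" "\<lambda>j. n - j"]) auto
    finally show ?thesis .
  qed
  \<comment> \<open>The denominator is the numerator with \<open>k = 1\<close>, so the same
    reindexing serves both, and the factor \<open>\<mu>\<close> cancels.\<close>
  have "n - j + 2 = n - j + 1 + 1" for j by simp
  then show ?thesis
    unfolding consec_coeff_def *[symmetric] using \<mu> by simp
qed

text \<open>A mean as a sum of tails, for the shifted sequence \<open>a (i + k)\<close>. This is
  where the sum in the theorem comes from.\<close>

lemma shifted_f_sums: "(\<lambda>m. f (m + k)) sums (\<Sum>\<^sub>\<infinity>i\<in>{1..}. real i * a (i + k))"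
proof -
  define b where "b i = a (i + k)" for i
  have b: "summable b" "\<And>i. 0 \<le> b i"
    using a_summable a_nonneg unfolding b_def by (auto simp: summable_iff_shift)
  have "summable (\<lambda>i. real (i + k) * a (i + k))"
    using summable_ignore_initial_segment[OF sums_summable[OF a_mean]] .
  then have s: "summable (\<lambda>i. real i * b i)"
    by (rule summable_comparison_test'[where N = 0])
      (use a_nonneg in \<open>auto simp: b_def intro!: mult_right_mono\<close>)
  have "tail_sum b sums (\<Sum>i. real i * b i)"
    by (rule tail_sum_sums[OF b summable_sums[OF s]])
  moreover have "tail_sum b = (\<lambda>m. f (m + k))"
    by (simp add: tail_sum_def f_def b_def fun_eq_iff add_ac)
  moreover have "(\<Sum>\<^sub>\<infinity>i\<in>{1..}. real i * b i) = (\<Sum>i. real i * b i)"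
    using infsum_atLeast_eq_suminf[OF s, of 1] b(2) suminf_split_head[OF s] by simp
  ultimately show ?thesis by (simp add: b_def)
qed

section \<open>The exponential tilt and bounds for its root\<close>

text \<open>Intermediate value theorem: the power series with coefficients \<open>f\<close> is
  continuous on the closed unit interval, with value \<open>f 0 < 1\<close> at 0 and
  \<open>1 + \<delta> > 1\<close> at 1.\<close>

lemma tilt_exists: "\<exists>z. 0 < z \<and> z < 1 \<and> (\<lambda>m. f m * z ^ m) sums 1"
proof -
  define F where "F z = (\<Sum>m. f m * z ^ m)" for z :: real
  have le: "norm (f m * z ^ m) \<le> f m" if "z \<in> {0..1}" for m and z :: real
    using that f_nonneg[of m] by (auto simp: abs_mult power_le_one intro!: mult_right_le_one_le)
  have ul: "uniform_limit {0..1} (\<lambda>n z. \<Sum>m<n. f m * z ^ m) F sequentially"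
    unfolding F_def using le f_summable by (intro Weierstrass_m_test) auto
  have "continuous_on {0..1} F"
    by (rule uniform_limit_theorem[OF _ ul]) (auto intro!: always_eventually continuous_intros)
  moreover have F0: "F 0 = f 0" unfolding F_def using powser_zero[of f] by simp
  moreover have F1: "F 1 = 1 + \<delta>" unfolding F_def using f_sums by (simp add: sums_iff)
  ultimately obtain z where z: "0 \<le> z" "z \<le> 1" "F z = 1"
    using IVT'[of F 0 1 1] a0_pos f0_eq \<delta> by auto
  have "summable (\<lambda>m. f m * z ^ m)"
    by (rule summable_comparison_test'[OF f_summable, where N = 0]) (use le z in auto)
  then have "(\<lambda>m. f m * z ^ m) sums 1" using z(3) unfolding F_def by (simp add: sums_iff)
  moreover have "z \<noteq> 0" using z F0 a0_pos f0_eq by auto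
  moreover have "z \<noteq> 1" using z F1 \<delta> by auto
  ultimately show ?thesis using z by (intro exI[of _ z]) auto
qed

definition "z = (SOME z. 0 < z \<and> z < 1 \<and> (\<lambda>m. f m * z ^ m) sums 1)"

lemma z_pos: "0 < z" and z_less: "z < 1" and tilt_sums: "(\<lambda>m. f m * z ^ m) sums 1"
  using someI_ex[OF tilt_exists] unfolding z_def by auto

lemma z_pow_le: "z ^ m \<le> 1"
  using z_pos z_less by (simp add: power_le_one)

lemma one_minus_z_pow: "real m * (1 - z) - real m ^ 2 * (1 - z) ^ 2 \<le> 1 - z ^ m"
    "1 - z ^ m \<le> real m * (1 - z)"
  using power_one_minus_le[of "1 - z" m] Bernoulli_inequality[of "z - 1" m] z_pos z_less
  by (auto simp: algebra_simps)

text \<open>The excess \<open>\<delta>\<close> is exactly the mass that tilting removes; bounding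
  \<open>1 - z ^ m\<close> term by term turns this into bounds on \<open>1 - z\<close>.\<close>

lemma deficit_sums: "(\<lambda>m. f m * (1 - z ^ m)) sums \<delta>"
  using sums_diff[OF f_sums tilt_sums] by (simp add: algebra_simps)

lemma delta_le: "\<delta> \<le> (1 - z) * (\<rho>\<^sub>2 / 2)"
proof (rule sums_le[OF _ deficit_sums sums_mult[OF f_mean]])
  show "f m * (1 - z ^ m) \<le> (1 - z) * (real m * f m)" for m
    using mult_left_mono[OF one_minus_z_pow(2) f_nonneg, of m m] by (simp add: mult_ac)
qed

lemma delta_ge: "(1 - z) * (\<rho>\<^sub>2 / 2) - (1 - z) ^ 2 * (\<rho>\<^sub>2 / 2 + \<rho>\<^sub>3 / 3) \<le> \<delta>"
proof (rule sums_le[OF _ sums_diff[OF sums_mult[OF f_mean] sums_mult[OF f_second_moment]] deficit_sums])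
  show "(1 - z) * (real m * f m) - (1 - z) ^ 2 * (real m ^ 2 * f m) \<le> f m * (1 - z ^ m)" for m
    using mult_left_mono[OF one_minus_z_pow(1) f_nonneg, of m m] by (simp add: algebra_simps)
qed

text \<open>Each positive index loses at least the fraction \<open>1 - z\<close> of its mass, and
  the mass off 0 is \<open>a 0 + \<delta>\<close>.\<close>

lemma z_ge: "a 0 / (a 0 + \<delta>) \<le> z"
proof -
  have "(1 - z) * (1 + \<delta> - f 0) \<le> \<delta>"
  proof (rule sums_le[OF _ _ deficit_sums])
    have "(\<lambda>m. f m - (if m = 0 then f 0 else 0)) sums (1 + \<delta> - f 0)"
      by (intro sums_diff f_sums sums_single)
    then show "(\<lambda>m. (1 - z) * (f m - (if m = 0 then f 0 else 0))) sums ((1 - z) * (1 + \<delta> - f 0))"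
      by (rule sums_mult)
    show "(1 - z) * (f m - (if m = 0 then f 0 else 0)) \<le> f m * (1 - z ^ m)" for m
    proof (cases m)
      case (Suc n)
      have "z ^ m \<le> z" unfolding Suc using z_pow_le[of n] z_pos by (simp add: mult_left_le)
      then show ?thesis using Suc mult_left_mono[of "1 - z" "1 - z ^ m" "f m"] f_nonneg by (simp add: mult.commute)
    qed simp
  qed
  then have "a 0 \<le> z * (a 0 + \<delta>)" using f0_eq by (simp add: algebra_simps)
  then show ?thesis using a0_pos \<delta> by (simp add: divide_le_eq)
qed

lemma one_minus_z_le: "1 - z \<le> \<delta> / a 0"
proof -
  have "1 - z \<le> 1 - a 0 / (a 0 + \<delta>)" using z_ge by simp
  also have "\<dots> = \<delta> / (a 0 + \<delta>)" using a0_pos \<delta> by (simp add: field_simps)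
  also have "\<dots> \<le> \<delta> / a 0" using a0_pos \<delta> by (intro divide_left_mono) auto
  finally show ?thesis .
qed

text \<open>Bounds the growth removed by the tilt for all \<open>n\<close> at once, as domination
  requires, and not only asymptotically.\<close>

lemma inverse_z_pow_le: "1 / z ^ n \<le> exp (\<delta> * real n / a 0)"
proof -
  have "1 / z \<le> 1 / (a 0 / (a 0 + \<delta>))" using z_ge z_pos a0_pos \<delta> by (intro divide_left_mono) auto
  also have "\<dots> = 1 + \<delta> / a 0" using a0_pos by (simp add: field_simps)
  also have "\<dots> \<le> exp (\<delta> / a 0)" by simp
  finally have "(1 / z) ^ n \<le> exp (\<delta> / a 0) ^ n" using z_pos by (intro power_mono) auto
  then show ?thesis by (simp add: power_one_over exp_of_nat_mult[symmetric] field_simps)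
qed

lemma summable_tilt:
  assumes "\<And>m. 0 \<le> g m" "summable g"
  shows "summable (\<lambda>m. g m * z ^ m)" "(\<Sum>m. g m * z ^ m) \<le> suminf g"
proof -
  have le: "g m * z ^ m \<le> g m" for m using assms(1)[of m] z_pow_le[of m] by (simp add: mult_left_le)
  show s: "summable (\<lambda>m. g m * z ^ m)"
    by (rule summable_comparison_test'[OF assms(2), where N = 0])
      (use le assms(1) z_pos in \<open>auto simp: abs_mult\<close>)
  show "(\<Sum>m. g m * z ^ m) \<le> suminf g" by (rule suminf_le[OF le s assms(2)])
qed

text \<open>The factor \<open>z ^ n = z ^ m * z ^ (n - m)\<close> passes through the convolution,
  and weights of at most 1 only lower the moments.\<close>

lemma tilted_renewal_class:
  assumes "c \<le> z * f 1" "\<rho>\<^sub>2 / 2 + \<rho>\<^sub>3 / 3 \<le> K" "1 + \<delta> \<le> K"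
  shows "renewal_class c K (\<lambda>m. f m * z ^ m) (\<lambda>m. a m * z ^ m) (\<lambda>n. z ^ n * D n)"
  unfolding renewal_class_def
proof (intro conjI allI)
  have f2: "\<And>m. 0 \<le> real m ^ 2 * f m" "summable (\<lambda>m. real m ^ 2 * f m)"
    using f_nonneg sums_summable[OF f_second_moment] by auto
  have a1: "\<And>m. 0 \<le> real m * a m" "summable (\<lambda>m. real m * a m)"
    using a_nonneg sums_summable[OF a_mean] by auto
  show "0 \<le> f m * z ^ m" "0 \<le> a m * z ^ m" for m using f_nonneg a_nonneg z_pos by auto
  show "(\<lambda>m. f m * z ^ m) sums 1" by (rule tilt_sums)
  show "c \<le> f 1 * z ^ 1" using assms by (simp add: mult.commute)
  show "summable (\<lambda>m. real m ^ 2 * (f m * z ^ m))" "(\<Sum>m. real m ^ 2 * (f m * z ^ m)) \<le> K"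
    using summable_tilt[OF f2] sums_unique[OF f_second_moment] assms by (auto simp: mult.assoc)
  show "summable (\<lambda>m. a m * z ^ m)" "(\<Sum>m. a m * z ^ m) \<le> 1"
    using summable_tilt[OF a_nonneg a_summable] sums_unique[OF a_sums] by auto
  show "summable (\<lambda>m. real m * (a m * z ^ m))" "(\<Sum>m. real m * (a m * z ^ m)) \<le> K"
    using summable_tilt[OF a1] sums_unique[OF a_mean] assms by (auto simp: mult.assoc)
  show "renewal_eq (\<lambda>m. f m * z ^ m) (\<lambda>m. a m * z ^ m) (\<lambda>n. z ^ n * D n)"
    unfolding renewal_eq_def
  proof
    fix n
    have "z ^ n * D n = z ^ n * a n + (\<Sum>m\<le>n. z ^ n * (f m * D (n - m)))"
      by (subst D_renewal[unfolded renewal_eq_def, rule_format])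
        (simp add: distrib_left sum_distrib_left)
    also have "(\<Sum>m\<le>n. z ^ n * (f m * D (n - m))) = (\<Sum>m\<le>n. (f m * z ^ m) * (z ^ (n - m) * D (n - m)))"
    proof (rule sum.cong)
      fix m assume "m \<in> {..n}"
      then have "z ^ n = z ^ m * z ^ (n - m)" by (simp flip: power_add)
      then show "z ^ n * (f m * D (n - m)) = (f m * z ^ m) * (z ^ (n - m) * D (n - m))" by simp
    qed simp
    finally show "z ^ n * D n = a n * z ^ n + (\<Sum>m\<le>n. (f m * z ^ m) * (z ^ (n - m) * D (n - m)))"
      by (simp add: mult.commute)
  qed
qed

text \<open>Returns from the tilted to the original constants: by
  \<open>1 - z ^ m \<le> m * (1 - z)\<close>, the mean of \<open>f\<close> and the mass of
  \<open>a\<close> change by at most \<open>1 - z\<close> times the next moment.\<close>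

lemma tilted_limit_close:
  assumes "\<bar>y * (\<Sum>m. real m * (f m * z ^ m)) - (\<Sum>m. a m * z ^ m)\<bar> \<le> \<epsilon>" "0 \<le> y" "y \<le> Y"
  shows "\<bar>y * (\<rho>\<^sub>2 / 2) - 1\<bar> \<le> \<epsilon> + (1 - z) * (Y * (\<rho>\<^sub>2 / 2 + \<rho>\<^sub>3 / 3) + (1 + \<delta>))"
proof -
  have fm: "\<And>m. 0 \<le> real m * f m" "summable (\<lambda>m. real m * f m)"
    using f_nonneg sums_summable[OF f_mean] by auto
  have s1: "(\<lambda>m. real m * (f m * z ^ m)) sums (\<Sum>m. real m * (f m * z ^ m))"
    using summable_sums[OF summable_tilt(1)[OF fm]] by (simp add: mult.assoc)
  have s2: "(\<lambda>m. a m * z ^ m) sums (\<Sum>m. a m * z ^ m)"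
    using summable_sums[OF summable_tilt(1)[OF a_nonneg a_summable]] .
  have 1: "\<rho>\<^sub>2 / 2 - (\<Sum>m. real m * (f m * z ^ m)) \<le> (1 - z) * (\<rho>\<^sub>2 / 2 + \<rho>\<^sub>3 / 3)"
  proof (rule sums_le[OF _ sums_diff[OF f_mean s1] sums_mult[OF f_second_moment]])
    show "real m * f m - real m * (f m * z ^ m) \<le> (1 - z) * (real m ^ 2 * f m)" for m
      using mult_left_mono[OF one_minus_z_pow(2) fm(1), of m m] by (simp add: algebra_simps power2_eq_square)
  qed
  have 2: "0 \<le> \<rho>\<^sub>2 / 2 - (\<Sum>m. real m * (f m * z ^ m))"
    using summable_tilt(2)[OF fm] sums_unique[OF f_mean] by (simp add: mult.assoc)
  have 3: "1 - (\<Sum>m. a m * z ^ m) \<le> (1 - z) * (1 + \<delta>)"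
  proof (rule sums_le[OF _ sums_diff[OF a_sums s2] sums_mult[OF a_mean]])
    show "a m - a m * z ^ m \<le> (1 - z) * (real m * a m)" for m
      using mult_left_mono[OF one_minus_z_pow(2) a_nonneg, of m m] by (simp add: algebra_simps)
  qed
  have 4: "0 \<le> 1 - (\<Sum>m. a m * z ^ m)"
    using summable_tilt(2)[OF a_nonneg a_summable] sums_unique[OF a_sums] by simp
  have 5: "y * (\<rho>\<^sub>2 / 2 - (\<Sum>m. real m * (f m * z ^ m))) \<le> Y * ((1 - z) * (\<rho>\<^sub>2 / 2 + \<rho>\<^sub>3 / 3))"
    using 1 2 assms by (intro mult_mono) auto
  have 6: "0 \<le> y * (\<rho>\<^sub>2 / 2 - (\<Sum>m. real m * (f m * z ^ m)))" using 2 assms by simp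
  have 7: "y * (\<rho>\<^sub>2 / 2) - 1 = (y * (\<Sum>m. real m * (f m * z ^ m)) - (\<Sum>m. a m * z ^ m))
      + y * (\<rho>\<^sub>2 / 2 - (\<Sum>m. real m * (f m * z ^ m))) - (1 - (\<Sum>m. a m * z ^ m))"
    by (simp only: right_diff_distrib)
  have 8: "(1 - z) * (Y * (\<rho>\<^sub>2 / 2 + \<rho>\<^sub>3 / 3) + (1 + \<delta>))
      = Y * ((1 - z) * (\<rho>\<^sub>2 / 2 + \<rho>\<^sub>3 / 3)) + (1 - z) * (1 + \<delta>)"
    by (simp only: distrib_left mult.left_commute)
  show ?thesis unfolding 7 8 using assms(1) 3 4 5 6 by linarith
qed

text \<open>As \<open>f\<close> decreases, the numerator is termwise at most the denominator. Serves
  the domination.\<close>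

lemma consec_coeff_bounds:
  assumes "1 \<le> k"
  shows "0 \<le> consec_coeff l \<mu> B n k" "consec_coeff l \<mu> B n k \<le> 1"
proof -
  have nn: "0 \<le> (\<Sum>m<n. f (m + r) * D (n - m))" for r
    using f_nonneg D_nonneg by (intro sum_nonneg) auto
  have "(\<Sum>m<n. f (m + k) * D (n - m)) \<le> (\<Sum>m<n. f (m + 1) * D (n - m))"
    using D_nonneg assms by (intro sum_mono mult_right_mono f_antimono) auto
  then show "0 \<le> consec_coeff l \<mu> B n k" "consec_coeff l \<mu> B n k \<le> 1"
    unfolding consec_coeff_eq using nn[of 1] nn[of k] by (auto simp: divide_le_eq_1 intro!: divide_nonneg_nonneg)
qed

end

subsection \<open>Uniform asymptotics in heavy traffic\<close>

locale heavy_traffic =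
  fixes l \<mu> \<delta> :: "nat \<Rightarrow> real" and B :: "nat \<Rightarrow> real measure" and \<rho> :: real
  assumes queue: "\<And>N. supercritical_queue (l N) (\<mu> N) (\<delta> N) (B N)"
    and \<delta>_lim: "\<delta> \<longlonglongrightarrow> 0"
    and third_bounded: "Bseq (\<lambda>N. rho_moment (l N) (B N) 3)"
    and second_lim: "(\<lambda>N. rho_moment (l N) (B N) 2) \<longlonglongrightarrow> \<rho>"
begin

sublocale q: supercritical_queue "l N" "\<mu> N" "\<delta> N" "B N" for N
  by (rule queue)

abbreviation "m\<^sub>1 N \<equiv> rho_moment (l N) (B N) 2 / 2"
abbreviation "m\<^sub>2 N \<equiv> m\<^sub>1 N + rho_moment (l N) (B N) 3 / 3"

lemma \<rho>_ge: "1 \<le> \<rho>"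
  using second_lim by (rule LIMSEQ_le_const) (use q.\<rho>2_ge in auto)

text \<open>Convergent sequences are bounded, so the constants serve every \<open>N\<close>.
  Jensen's bound controls \<open>a 0\<close>, then \<open>f1_ge\<close> controls \<open>f 1\<close>
  and \<open>z_ge\<close> controls \<open>z\<close>.\<close>

lemma uniform_constants:
  obtains c K where "0 < c" "\<And>N. c \<le> q.z N * q.f N 1" "\<And>N. c \<le> q.a N 0"
    "\<And>N. m\<^sub>2 N \<le> K" "\<And>N. 1 + \<delta> N \<le> K"
proof -
  obtain \<Delta> where \<Delta>: "0 < \<Delta>" "\<And>N. \<bar>\<delta> N\<bar> \<le> \<Delta>"
    using convergent_imp_Bseq[OF convergentI[OF \<delta>_lim]] by (auto elim!: BseqE)
  obtain R2 where R2: "0 < R2" "\<And>N. \<bar>rho_moment (l N) (B N) 2\<bar> \<le> R2"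
    using convergent_imp_Bseq[OF convergentI[OF second_lim]] by (auto elim!: BseqE)
  obtain R3 where R3: "0 < R3" "\<And>N. \<bar>rho_moment (l N) (B N) 3\<bar> \<le> R3"
    using third_bounded by (auto elim!: BseqE)
  define \<alpha> where "\<alpha> = exp (- (1 + \<Delta>))"
  have \<alpha>: "0 < \<alpha>" unfolding \<alpha>_def by simp
  have a0: "\<alpha> \<le> q.a N 0" for N
    using q.a0_ge[of N] \<Delta>(2)[of N] unfolding \<alpha>_def by (smt (verit) exp_le_cancel_iff)
  \<comment> \<open>Makes the tail of \<open>f\<close> beyond \<open>M\<close> at most
    \<open>\<alpha> / 2\<close>, half of the mass guaranteed off 0.\<close>
  obtain M' :: nat where M': "R2 / \<alpha> < real M'" using reals_Archimedean2 by blast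
  define M where "M = Suc M'"
  have f1: "\<alpha> / (2 * real M) \<le> q.f N 1" for N
  proof -
    have "m\<^sub>1 N / real (Suc M) \<le> \<alpha> / 2"
    proof -
      have "R2 < \<alpha> * real M'" using M' \<alpha> by (simp add: divide_less_eq mult.commute)
      moreover have "\<alpha> * real M' \<le> \<alpha> * real (Suc M)" using \<alpha> unfolding M_def by (intro mult_left_mono) auto
      ultimately have "m\<^sub>1 N * 2 \<le> \<alpha> * real (Suc M)" using R2(2)[of N] by (simp add: abs_le_iff)
      then show ?thesis by (simp add: pos_divide_le_eq del: of_nat_Suc)
    qed
    then have "\<alpha> / 2 \<le> real M * q.f N 1" using q.f1_ge[of N M] a0[of N] by linarith
    then show ?thesis unfolding M_def by (simp add: field_simps)
  qed
  have z: "\<alpha> / (\<alpha> + \<Delta>) \<le> q.z N" for N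
  proof -
    have "\<alpha> / (\<alpha> + \<Delta>) \<le> q.a N 0 / (q.a N 0 + \<delta> N)"
    proof -
      have "\<alpha> * \<delta> N \<le> q.a N 0 * \<Delta>"
        using a0[of N] \<alpha> \<Delta>(2)[of N] q.\<delta>[of N] by (intro mult_mono) auto
      then show ?thesis using \<alpha> \<Delta>(1) a0[of N] q.\<delta>[of N] by (simp add: field_simps)
    qed
    then show ?thesis using q.z_ge[of N] by linarith
  qed
  define c where "c = min \<alpha> (\<alpha> / (\<alpha> + \<Delta>) * (\<alpha> / (2 * real M)))"
  have "0 < c" unfolding c_def M_def using \<alpha> \<Delta> by simp
  moreover have "c \<le> q.z N * q.f N 1" for N
  proof -
    have "\<alpha> / (\<alpha> + \<Delta>) * (\<alpha> / (2 * real M)) \<le> q.z N * q.f N 1"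
      using z f1 \<alpha> \<Delta> q.z_pos[of N] by (intro mult_mono) (auto simp: less_imp_le)
    then show ?thesis unfolding c_def by linarith
  qed
  moreover have "c \<le> q.a N 0" for N using a0[of N] unfolding c_def by linarith
  moreover have "m\<^sub>2 N \<le> R2 + R3 + 1 + \<Delta>" for N
    using R2(2)[of N] R3(2)[of N] \<Delta>(1) by (simp add: abs_le_iff)
  moreover have "1 + \<delta> N \<le> R2 + R3 + 1 + \<Delta>" for N
    using R2(1) R3(1) \<Delta>(2)[of N] by (simp add: abs_le_iff)
  ultimately show ?thesis by (rule that)
qed

definition "D\<^sub>z N n = q.z N ^ n * q.D N n"

lemma Dz_nonneg: "0 \<le> D\<^sub>z N n"
  unfolding D\<^sub>z_def using q.z_pos[of N] q.D_nonneg[of N n] by simp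

lemma z_lim: "q.z \<longlonglongrightarrow> 1"
proof -
  obtain c K where c: "0 < c" "\<And>N. c \<le> q.a N 0" using uniform_constants by metis
  have "(\<lambda>N. 1 - q.z N) \<longlonglongrightarrow> 0"
  proof (rule Lim_null_comparison[OF always_eventually])
    show "\<forall>N. norm (1 - q.z N) \<le> \<delta> N / c"
    proof
      fix N
      have "1 - q.z N \<le> \<delta> N / q.a N 0" by (rule q.one_minus_z_le)
      also have "\<dots> \<le> \<delta> N / c" using c q.\<delta>[of N] by (intro divide_left_mono) (auto intro: mult_pos_pos less_le_trans)
      finally show "norm (1 - q.z N) \<le> \<delta> N / c" using q.z_less[of N] by simp
    qed
    show "(\<lambda>N. \<delta> N / c) \<longlonglongrightarrow> 0" using tendsto_divide[OF \<delta>_lim tendsto_const[of c]] c by simp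
  qed
  from tendsto_diff[OF tendsto_const[of 1] this] show ?thesis by simp
qed

lemma Dz_bounded: obtains Y where "0 < Y" "\<And>N n. D\<^sub>z N n \<le> Y"
proof -
  obtain c K where c: "0 < c" "\<And>N. c \<le> q.z N * q.f N 1" "\<And>N. m\<^sub>2 N \<le> K" "\<And>N. 1 + \<delta> N \<le> K"
    using uniform_constants by metis
  have "D\<^sub>z N n \<le> 1 / c" for N n
    using renewal_class_le[OF q.tilted_renewal_class[OF c(2-4)] c(1)] unfolding D\<^sub>z_def by simp
  then show ?thesis using c(1) by (intro that[of "1 / c"]) auto
qed

text \<open>A large \<open>n\<close> is needed for the renewal theorem and a large \<open>N\<close>
  to bring \<open>z\<close> close to 1; the two requirements are independent, so no relation between
  \<open>n\<close> and \<open>N\<close> appears.\<close>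

lemma Dz_limit:
  assumes "0 < \<epsilon>"
  shows "\<exists>n0. \<forall>N\<ge>n0. \<forall>n\<ge>n0. \<bar>D\<^sub>z N n - 1 / m\<^sub>1 N\<bar> \<le> \<epsilon>"
proof -
  obtain c K where c: "0 < c" "\<And>N. c \<le> q.z N * q.f N 1" "\<And>N. m\<^sub>2 N \<le> K" "\<And>N. 1 + \<delta> N \<le> K"
    using uniform_constants by metis
  note cl = q.tilted_renewal_class[OF c(2-4)]
  obtain n1 where n1: "\<And>f b x n. renewal_class c K f b x \<Longrightarrow> n1 \<le> n \<Longrightarrow>
      \<bar>x n * (\<Sum>m. real m * f m) - suminf b\<bar> \<le> \<epsilon> / 4"
    using uniform_renewal[OF c(1), of "\<epsilon> / 4" K] assms by (metis zero_less_divide_iff zero_less_numeral)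
  \<comment> \<open>Bounds the bracket in \<open>tilted_limit_close\<close> when
    \<open>Y = 1 / c\<close>.\<close>
  define E where "E = 1 / c * K + K"
  have "(\<lambda>N. (1 - q.z N) * E) \<longlonglongrightarrow> (1 - 1) * E"
    by (intro tendsto_intros z_lim)
  then have "\<forall>\<^sub>F N in sequentially. (1 - q.z N) * E < \<epsilon> / 4"
    using assms by (intro order_tendstoD(2)[where y = "(1 - 1) * E"]) auto
  then obtain n2 where n2: "\<And>N. n2 \<le> N \<Longrightarrow> (1 - q.z N) * E < \<epsilon> / 4"
    by (auto simp: eventually_sequentially)
  have "\<bar>D\<^sub>z N n - 1 / m\<^sub>1 N\<bar> \<le> \<epsilon>" if N: "max n1 n2 \<le> N" and n: "max n1 n2 \<le> n" for N n
  proof -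
    have "\<bar>D\<^sub>z N n * m\<^sub>1 N - 1\<bar> \<le> \<epsilon> / 4 + (1 - q.z N) * (1 / c * m\<^sub>2 N + (1 + \<delta> N))"
      using n1[OF cl, of n N] n renewal_class_le[OF cl c(1), of N n] renewal_class_nonneg[OF cl c(1), of N n]
      unfolding D\<^sub>z_def by (intro q.tilted_limit_close) auto
    also have "(1 - q.z N) * (1 / c * m\<^sub>2 N + (1 + \<delta> N)) \<le> (1 - q.z N) * E"
      unfolding E_def using c q.z_less[of N] by (intro mult_left_mono add_mono) auto
    also have "\<dots> \<le> \<epsilon> / 4" using n2[of N] N by simp
    finally have *: "\<bar>D\<^sub>z N n * m\<^sub>1 N - 1\<bar> \<le> \<epsilon> / 2" by simp
    have m: "1 / 2 \<le> m\<^sub>1 N" using q.\<rho>2_ge[of N] by simp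
    have "D\<^sub>z N n - 1 / m\<^sub>1 N = (D\<^sub>z N n * m\<^sub>1 N - 1) / m\<^sub>1 N" using m by (simp add: diff_divide_distrib)
    then have "\<bar>D\<^sub>z N n - 1 / m\<^sub>1 N\<bar> = \<bar>D\<^sub>z N n * m\<^sub>1 N - 1\<bar> / \<bar>m\<^sub>1 N\<bar>"
      by (simp only: abs_divide)
    also have "\<bar>m\<^sub>1 N\<bar> = m\<^sub>1 N" using m by linarith
    also have "\<bar>D\<^sub>z N n * m\<^sub>1 N - 1\<bar> / m\<^sub>1 N \<le> (\<epsilon> / 2) / (1 / 2)" using * m assms by (intro frac_le) auto
    finally show ?thesis by simp
  qed
  then show ?thesis by blast
qed

text \<open>Distributing \<open>z ^ n\<close> gives the factors
  \<open>z ^ m * D\<^sub>z N (n - m)\<close>. For \<open>m\<close> up to a fixed \<open>I\<close>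
  they are close to \<open>1 / m\<^sub>1 N\<close>; the weights beyond \<open>I\<close> are small by
  \<open>tail\<close>.\<close>

lemma convolution_limit:
  fixes g :: "nat \<Rightarrow> nat \<Rightarrow> real" and G :: "nat \<Rightarrow> real" and n :: "nat \<Rightarrow> nat"
  assumes g: "\<And>N m. 0 \<le> g N m" "\<And>N. g N sums G N" "\<And>N. G N \<le> R"
    and tail: "\<And>N I. real (Suc I) * tail_sum (g N) I \<le> R"
    and n: "filterlim n at_top sequentially"
  shows "(\<lambda>N. q.z N ^ n N * (\<Sum>m<n N. g N m * q.D N (n N - m)) - G N / m\<^sub>1 N) \<longlonglongrightarrow> 0"
proof (rule LIMSEQ_I)
  fix e :: real assume e: "0 < e"
  obtain Y where Y: "0 < Y" "\<And>N n. D\<^sub>z N n \<le> Y" using Dz_bounded by blast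
  have v: "0 \<le> 1 / m\<^sub>1 N" "1 / m\<^sub>1 N \<le> 2" for N
    using q.\<rho>2_ge[of N] by (auto simp: divide_le_eq)
  have G0: "0 \<le> G N" for N using sums_le[OF g(1) sums_zero g(2)] by simp
  have R: "0 \<le> R" using G0[of 0] g(3)[of 0] by linarith
  \<comment> \<open>Beyond \<open>I\<close> the deviation is at most \<open>Y + 2\<close> and the
    limit at most 2, hence \<open>Y + 4\<close>; with the tail bound \<open>R / Suc I\<close> this
    stays below \<open>e / 2\<close>.\<close>
  obtain I :: nat where I: "(Y + 4) * R * 4 / e < real I" using reals_Archimedean2 by blast
  define \<epsilon> where "\<epsilon> = e / 4 / (R + 1)"
  have \<epsilon>: "0 < \<epsilon>" unfolding \<epsilon>_def using e R by simp
  obtain n0 where n0: "\<And>N n. n0 \<le> N \<Longrightarrow> n0 \<le> n \<Longrightarrow> \<bar>D\<^sub>z N n - 1 / m\<^sub>1 N\<bar> \<le> \<epsilon>"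
    using Dz_limit[OF \<epsilon>] by blast
  have "(\<lambda>N. (1 - q.z N) * (real I * Y)) \<longlonglongrightarrow> (1 - 1) * (real I * Y)"
    by (intro tendsto_intros z_lim)
  then have z_small: "\<forall>\<^sub>F N in sequentially. (1 - q.z N) * (real I * Y) < \<epsilon>"
    using \<epsilon> by (intro order_tendstoD(2)[where y = "(1 - 1) * (real I * Y)"]) auto
  have "\<forall>\<^sub>F N in sequentially. n0 + I < n N"
    using filterlim_at_top[THEN iffD1, rule_format, OF n, of "n0 + I + 1"] by eventually_elim simp
  then have "\<forall>\<^sub>F N in sequentially. norm (q.z N ^ n N * (\<Sum>m<n N. g N m * q.D N (n N - m)) - G N / m\<^sub>1 N - 0) < e"
    using z_small eventually_ge_at_top[of n0]
  proof eventually_elim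
    case (elim N)
    have "q.z N ^ n N * (\<Sum>m<n N. g N m * q.D N (n N - m)) = (\<Sum>m<n N. g N m * (q.z N ^ m * D\<^sub>z N (n N - m)))"
      unfolding sum_distrib_left
    proof (rule sum.cong)
      fix m assume "m \<in> {..<n N}"
      then have "q.z N ^ n N = q.z N ^ m * q.z N ^ (n N - m)" by (simp flip: power_add)
      then show "q.z N ^ n N * (g N m * q.D N (n N - m)) = g N m * (q.z N ^ m * D\<^sub>z N (n N - m))"
        by (simp add: D\<^sub>z_def)
    qed simp
    moreover have "\<bar>(\<Sum>m<n N. g N m * (q.z N ^ m * D\<^sub>z N (n N - m))) - 1 / m\<^sub>1 N * G N\<bar>
        \<le> (2 * \<epsilon>) * G N + ((Y + 2) + \<bar>1 / m\<^sub>1 N\<bar>) * tail_sum (g N) I"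
    proof (rule weighted_sum_close[OF g(1,2)])
      show "I < n N" using elim by simp
      show "\<bar>q.z N ^ m * D\<^sub>z N (n N - m) - 1 / m\<^sub>1 N\<bar> \<le> 2 * \<epsilon>" if "m \<le> I" for m
      proof -
        have "\<bar>D\<^sub>z N (n N - m) - 1 / m\<^sub>1 N\<bar> \<le> \<epsilon>" using elim that by (intro n0) auto
        moreover have "(1 - q.z N ^ m) * D\<^sub>z N (n N - m) \<le> (1 - q.z N) * (real I * Y)"
        proof -
          have "(1 - q.z N ^ m) * D\<^sub>z N (n N - m) \<le> (real m * (1 - q.z N)) * Y"
            using Y Dz_nonneg q.one_minus_z_pow(2)[of N m] q.z_less[of N] by (intro mult_mono) auto
          also have "\<dots> \<le> (real I * (1 - q.z N)) * Y"
            using that Y q.z_less[of N] by (intro mult_right_mono) auto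
          finally show ?thesis by (simp add: mult_ac)
        qed
        moreover have "0 \<le> (1 - q.z N ^ m) * D\<^sub>z N (n N - m)"
          using Dz_nonneg q.z_pow_le[of N m] by (intro mult_nonneg_nonneg) auto
        moreover have "q.z N ^ m * D\<^sub>z N (n N - m) = D\<^sub>z N (n N - m) - (1 - q.z N ^ m) * D\<^sub>z N (n N - m)"
          by (simp add: algebra_simps)
        ultimately show ?thesis using elim(2) by linarith
      qed
      show "\<bar>q.z N ^ m * D\<^sub>z N (n N - m) - 1 / m\<^sub>1 N\<bar> \<le> Y + 2" if "m < n N" for m
      proof -
        have "q.z N ^ m * D\<^sub>z N (n N - m) \<le> 1 * Y"
          using Y Dz_nonneg q.z_pow_le[of N m] by (intro mult_mono) auto
        moreover have "0 \<le> q.z N ^ m * D\<^sub>z N (n N - m)"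
          using Dz_nonneg q.z_pos[of N] by simp
        ultimately show ?thesis using v[of N] by linarith
      qed
    qed (use \<epsilon> Y in auto)
    moreover have "(2 * \<epsilon>) * G N \<le> e / 2"
    proof -
      have "(2 * \<epsilon>) * G N \<le> (2 * \<epsilon>) * (R + 1)" using \<epsilon> g(3)[of N] by (intro mult_left_mono) auto
      also have "\<dots> = e / 2"
      proof -
        have "R + 1 \<noteq> 0" using R by linarith
        then show ?thesis unfolding \<epsilon>_def by (simp add: divide_eq_eq)
      qed
      finally show ?thesis .
    qed
    moreover have "((Y + 2) + \<bar>1 / m\<^sub>1 N\<bar>) * tail_sum (g N) I < e / 2"
    proof -
      have t: "0 \<le> tail_sum (g N) I" using g(1,2) by (intro tail_sum_nonneg) (auto simp: sums_iff)
      have "((Y + 2) + \<bar>1 / m\<^sub>1 N\<bar>) * tail_sum (g N) I \<le> (Y + 4) * tail_sum (g N) I"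
        using v[of N] t by (intro mult_right_mono) auto
      also have "\<dots> \<le> (Y + 4) * (R / real (Suc I))"
        using tail[of I N] Y by (intro mult_left_mono) (auto simp: field_simps)
      also have "\<dots> < e / 2"
      proof -
        have "(Y + 4) * R * 4 < e * real I" using I e by (simp add: divide_less_eq mult.commute)
        also have "\<dots> \<le> e * real (Suc I)" using e by (intro mult_left_mono) auto
        finally have "(Y + 4) * R * 4 < e * real (Suc I)" .
        moreover have "0 \<le> (Y + 4) * R" using Y R by simp
        ultimately have "(Y + 4) * R < e / 2 * real (Suc I)" by linarith
        then show ?thesis by (simp add: pos_divide_less_eq del: of_nat_Suc)
      qed
      finally show ?thesis .
    qed
    moreover have "G N / m\<^sub>1 N = 1 / m\<^sub>1 N * G N" by simp
    ultimately show ?case unfolding real_norm_def diff_0_right by linarith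
  qed
  then show "\<exists>no. \<forall>N\<ge>no. norm (q.z N ^ n N * (\<Sum>m<n N. g N m * q.D N (n N - m)) - G N / m\<^sub>1 N - 0) < e"
    by (simp add: eventually_sequentially)
qed

end

section \<open>Limits and bounds for the loss quantities\<close>

context heavy_traffic
begin

definition "\<Phi> N k = (\<Sum>\<^sub>\<infinity>i\<in>{1..}. real i * q.a N (i + k))"

lemma \<Phi>_sums: "(\<lambda>m. q.f N (m + k)) sums \<Phi> N k"
  unfolding \<Phi>_def by (rule q.shifted_f_sums)

lemma \<Phi>_nonneg: "0 \<le> \<Phi> N k"
  using sums_le[OF _ sums_zero \<Phi>_sums] q.f_nonneg by simp

text \<open>Dropping \<open>f 0 = 1 - a 0\<close> from the mass \<open>1 + \<delta>\<close>. This
  produces the Laplace transform in the denominator of the theorem.\<close>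

lemma \<Phi>_1: "\<Phi> N 1 = q.a N 0 + \<delta> N"
proof -
  have "(\<lambda>m. q.f N (Suc m)) sums (1 + \<delta> N - q.f N 0)"
    using q.f_sums[of N] by (subst sums_Suc_iff) simp
  moreover have "(\<lambda>m. q.f N (Suc m)) sums \<Phi> N 1" using \<Phi>_sums[of N 1] by simp
  ultimately have "1 + \<delta> N - q.f N 0 = \<Phi> N 1" by (rule sums_unique2)
  then show ?thesis using q.f0_eq[of N] by simp
qed

lemma \<Phi>_le: "\<Phi> N k \<le> 1 + \<delta> N"
  by (rule sums_le[OF _ \<Phi>_sums q.f_sums]) (simp add: q.f_antimono)

lemma shifted_f_tail: "real (Suc I) * tail_sum (\<lambda>m. q.f N (m + k)) I \<le> m\<^sub>2 N"
proof -
  have "tail_sum (\<lambda>m. q.f N (m + k)) I \<le> tail_sum (q.f N) I"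
    unfolding tail_sum_def
    using q.f_antimono[of _ _ N] summable_ignore_initial_segment[OF q.f_summable, of N "Suc I"]
      summable_ignore_initial_segment[OF q.f_summable, of N "Suc I + k"]
    by (intro suminf_le) (auto simp: add.assoc simp del: add_Suc_right)
  then have "real (Suc I) * tail_sum (\<lambda>m. q.f N (m + k)) I \<le> real (Suc I) * tail_sum (q.f N) I"
    by (intro mult_left_mono) auto
  also have "\<dots> \<le> m\<^sub>1 N" by (rule index_mult_tail_sum_le[OF q.f_summable q.f_nonneg q.f_mean])
  finally show ?thesis using q.\<rho>3_nonneg[of N] by simp
qed

lemma Q_tail: "real (Suc I) * tail_sum (q.Q N) I \<le> m\<^sub>2 N"
proof -
  have "real (Suc I) * tail_sum (q.Q N) I \<le> rho_moment (l N) (B N) 3 / 6"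
    by (rule index_mult_tail_sum_le[OF sums_summable[OF q.Q_sums] q.Q_nonneg q.Q_mean])
  then show ?thesis using q.\<rho>3_nonneg[of N] q.\<rho>2_ge[of N] by simp
qed

lemma tilt_rate: "(\<lambda>N. (1 - q.z N) / \<delta> N) \<longlonglongrightarrow> 2 / \<rho>"
proof -
  obtain K where K: "\<And>N. m\<^sub>2 N \<le> K" using uniform_constants by metis
  have pos: "0 < 1 - q.z N" for N using q.z_less[of N] by simp
  \<comment> \<open>The reciprocal is squeezed, since \<open>delta_le\<close> and
    \<open>delta_ge\<close> bound \<open>\<delta>\<close> in terms of \<open>1 - z\<close>.\<close>
  have "(\<lambda>N. \<delta> N / (1 - q.z N)) \<longlonglongrightarrow> \<rho> / 2"
  proof (rule tendsto_sandwich)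
    show "\<forall>\<^sub>F N in sequentially. m\<^sub>1 N - (1 - q.z N) * K \<le> \<delta> N / (1 - q.z N)"
    proof (intro always_eventually allI)
      fix N
      have "(m\<^sub>1 N - (1 - q.z N) * K) * (1 - q.z N) \<le> (1 - q.z N) * m\<^sub>1 N - (1 - q.z N) ^ 2 * m\<^sub>2 N"
      proof -
        have "(1 - q.z N) ^ 2 * m\<^sub>2 N \<le> (1 - q.z N) ^ 2 * K" by (intro mult_left_mono K) simp
        moreover have "(m\<^sub>1 N - (1 - q.z N) * K) * (1 - q.z N) = (1 - q.z N) * m\<^sub>1 N - (1 - q.z N) ^ 2 * K"
          by (simp add: left_diff_distrib[of "m\<^sub>1 N"] power2_eq_square)
        ultimately show ?thesis by linarith
      qed
      also have "\<dots> \<le> \<delta> N" by (rule q.delta_ge)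
      finally show "m\<^sub>1 N - (1 - q.z N) * K \<le> \<delta> N / (1 - q.z N)" using pos[of N] by (simp add: pos_le_divide_eq)
    qed
    show "\<forall>\<^sub>F N in sequentially. \<delta> N / (1 - q.z N) \<le> m\<^sub>1 N"
      using q.delta_le pos by (intro always_eventually allI) (simp add: pos_divide_le_eq mult.commute)
    have "(\<lambda>N. m\<^sub>1 N - (1 - q.z N) * K) \<longlonglongrightarrow> \<rho> / 2 - (1 - 1) * K"
      by (intro tendsto_intros second_lim z_lim) auto
    then show "(\<lambda>N. m\<^sub>1 N - (1 - q.z N) * K) \<longlonglongrightarrow> \<rho> / 2" by simp
    show "m\<^sub>1 \<longlonglongrightarrow> \<rho> / 2" by (intro tendsto_intros second_lim) auto
  qed
  then have "(\<lambda>N. inverse (\<delta> N / (1 - q.z N))) \<longlonglongrightarrow> inverse (\<rho> / 2)"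
    using \<rho>_ge by (intro tendsto_inverse) auto
  then show ?thesis by (simp add: field_simps)
qed

text \<open>The exponent \<open>n * ln z\<close> is the product of \<open>ln z / (z - 1)\<close>, a
  difference quotient of the logarithm at 1, of \<open>- (1 - z) / \<delta>\<close>, and of
  \<open>\<delta> * n\<close>.\<close>

lemma z_pow_limit:
  assumes "(\<lambda>N. \<delta> N * real (n N)) \<longlonglongrightarrow> C"
  shows "(\<lambda>N. q.z N ^ n N) \<longlonglongrightarrow> exp (- (2 * C / \<rho>))"
proof -
  have "((\<lambda>x::real. ln (1 + x) / x) \<longlongrightarrow> 1) (at 0)"
  proof -
    have "((\<lambda>x::real. ln (1 + x)) has_real_derivative 1) (at 0)"
      by (auto intro!: derivative_eq_intros)
    then show ?thesis by (simp add: DERIV_def)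
  qed
  moreover have "filterlim (\<lambda>N. q.z N - 1) (at 0) sequentially"
  proof -
    have "(\<lambda>N. q.z N - 1) \<longlonglongrightarrow> 1 - 1" by (intro tendsto_intros z_lim)
    then show ?thesis using q.z_less by (auto simp: filterlim_at less_imp_neq)
  qed
  ultimately have "(\<lambda>N. ln (1 + (q.z N - 1)) / (q.z N - 1)) \<longlonglongrightarrow> 1"
    by (rule filterlim_compose)
  then have "(\<lambda>N. ln (1 + (q.z N - 1)) / (q.z N - 1) * (- ((1 - q.z N) / \<delta> N)) * (\<delta> N * real (n N)))
      \<longlonglongrightarrow> 1 * (- (2 / \<rho>)) * C"
    by (intro tendsto_intros tilt_rate assms)
  moreover have "ln (1 + (q.z N - 1)) / (q.z N - 1) * (- ((1 - q.z N) / \<delta> N)) * (\<delta> N * real (n N))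
      = real (n N) * ln (q.z N)" for N
    using q.z_less[of N] q.\<delta>[of N] by (simp add: field_simps)
  ultimately have "(\<lambda>N. exp (real (n N) * ln (q.z N))) \<longlonglongrightarrow> exp (1 * (- (2 / \<rho>)) * C)"
    by (intro tendsto_exp) simp
  then show ?thesis using q.z_pos by (simp add: exp_of_nat_mult)
qed

text \<open>The mass of \<open>Q\<close> is the very constant by which
  \<open>convolution_limit\<close> divides, so the limit is that of \<open>1 / z ^ n\<close>; the
  extra term \<open>Q (n - 1)\<close> is of order \<open>1 / n\<close>.\<close>

lemma mean_losses_limit:
  assumes n: "filterlim n at_top sequentially" and C: "(\<lambda>N. \<delta> N * real (n N)) \<longlonglongrightarrow> C"
  shows "(\<lambda>N. mean_losses (l N) (\<mu> N) (B N) (n N)) \<longlonglongrightarrow> exp (2 * C / \<rho>)"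
proof -
  obtain K where K: "\<And>N. m\<^sub>2 N \<le> K" using uniform_constants by metis
  have m: "m\<^sub>1 N \<le> K" for N using K[of N] q.\<rho>3_nonneg[of N] by simp
  let ?S = "\<lambda>N. \<Sum>m<n N. q.Q N m * q.D N (n N - m)"
  have "(\<lambda>N. q.z N ^ n N * ?S N - m\<^sub>1 N / m\<^sub>1 N) \<longlonglongrightarrow> 0"
    using m K by (intro convolution_limit[OF _ _ _ _ n, where R = K] q.Q_nonneg q.Q_sums order_trans[OF Q_tail]) auto
  moreover have "m\<^sub>1 N / m\<^sub>1 N = 1" for N using q.\<rho>2_ge[of N] by simp
  ultimately have "(\<lambda>N. q.z N ^ n N * ?S N - 1) \<longlonglongrightarrow> 0" by simp
  from tendsto_add[OF this tendsto_const[of 1]] have "(\<lambda>N. q.z N ^ n N * ?S N) \<longlonglongrightarrow> 1" by simp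
  from tendsto_divide[OF this z_pow_limit[OF C]]
  have "(\<lambda>N. q.z N ^ n N * ?S N / q.z N ^ n N) \<longlonglongrightarrow> 1 / exp (- (2 * C / \<rho>))" by simp
  moreover have "q.z N ^ n N * ?S N / q.z N ^ n N = ?S N" for N using q.z_pos[of N] by simp
  moreover have "1 / exp (- (2 * C / \<rho>)) = exp (2 * C / \<rho>)" by (simp add: exp_minus divide_inverse)
  ultimately have S: "?S \<longlonglongrightarrow> exp (2 * C / \<rho>)" by (simp only:)
  have n1: "\<forall>\<^sub>F N in sequentially. 1 \<le> n N" using n by (simp add: filterlim_at_top)
  have Q0: "(\<lambda>N. q.Q N (n N - 1)) \<longlonglongrightarrow> 0"
  proof (rule Lim_null_comparison)
    show "\<forall>\<^sub>F N in sequentially. norm (q.Q N (n N - 1)) \<le> K / real (n N)"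
      using n1
    proof eventually_elim
      case (elim N)
      have "real (Suc (n N - 1)) * q.Q N (n N - 1) \<le> m\<^sub>1 N"
        unfolding q.Q_def by (rule index_mult_tail_sum_le[OF q.f_summable q.f_nonneg q.f_mean])
      then show ?case using elim m[of N] q.Q_nonneg[of N] by (simp add: field_simps)
    qed
    have "filterlim (\<lambda>N. real (n N)) at_top sequentially"
      by (rule filterlim_compose[OF filterlim_real_sequentially n])
    then show "(\<lambda>N. K / real (n N)) \<longlonglongrightarrow> 0"
      by (intro real_tendsto_divide_at_top[OF tendsto_const])
  qed
  have "(\<lambda>N. q.Q N (n N - 1) + ?S N) \<longlonglongrightarrow> exp (2 * C / \<rho>)" using tendsto_add[OF Q0 S] by simp
  then show ?thesis
  proof (rule Lim_transform_eventually)
    show "\<forall>\<^sub>F N in sequentially. q.Q N (n N - 1) + ?S N = mean_losses (l N) (\<mu> N) (B N) (n N)"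
      using n1 by eventually_elim (simp add: q.mean_losses_eq)
  qed
qed

text \<open>The powers of \<open>z\<close> and the factor \<open>m\<^sub>1\<close> cancel in the
  quotient, leaving \<open>\<Phi> N k\<close> over \<open>\<Phi> N 1\<close>, and
  \<open>\<Phi> N 1\<close> differs from \<open>a 0\<close> by \<open>\<delta>\<close>.\<close>

lemma consec_coeff_limit:
  assumes n: "filterlim n at_top sequentially"
  shows "(\<lambda>N. consec_coeff (l N) (\<mu> N) (B N) (n N) k - \<Phi> N k / q.a N 0) \<longlonglongrightarrow> 0"
proof -
  obtain c K where c: "0 < c" "\<And>N. c \<le> q.a N 0" and K: "\<And>N. m\<^sub>2 N \<le> K" "\<And>N. 1 + \<delta> N \<le> K"
    using uniform_constants by metis
  define p where "p r N = q.z N ^ n N * (\<Sum>m<n N. q.f N (m + r) * q.D N (n N - m))" for r N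
  have K0: "0 \<le> K" using K(2)[of 0] q.\<delta>[of 0] by linarith
  have "(\<lambda>N. p r N - \<Phi> N r / m\<^sub>1 N) \<longlonglongrightarrow> 0" for r
    unfolding p_def using K
    by (intro convolution_limit[OF _ _ _ _ n, where R = K] q.f_nonneg \<Phi>_sums
        order_trans[OF shifted_f_tail] order_trans[OF \<Phi>_le]) auto
  then have "(\<lambda>N. m\<^sub>1 N * (p r N - \<Phi> N r / m\<^sub>1 N)) \<longlonglongrightarrow> \<rho> / 2 * 0" for r
    by (intro tendsto_intros second_lim) auto
  moreover have "m\<^sub>1 N * (p r N - \<Phi> N r / m\<^sub>1 N) = m\<^sub>1 N * p r N - \<Phi> N r" for r N
  proof -
    have "m\<^sub>1 N \<noteq> 0" using q.\<rho>2_ge[of N] by simp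
    then have "m\<^sub>1 N * (\<Phi> N r / m\<^sub>1 N) = \<Phi> N r" by (metis nonzero_mult_div_cancel_left times_divide_eq_right)
    then show ?thesis by (simp only: right_diff_distrib)
  qed
  ultimately have p: "(\<lambda>N. m\<^sub>1 N * p r N - \<Phi> N r) \<longlonglongrightarrow> 0" for r
    by (simp only: mult_zero_right)
  have "(\<lambda>N. (m\<^sub>1 N * p 1 N - \<Phi> N 1) + \<delta> N) \<longlonglongrightarrow> 0 + 0"
    by (intro tendsto_add p \<delta>_lim)
  moreover have "(m\<^sub>1 N * p 1 N - \<Phi> N 1) + \<delta> N = m\<^sub>1 N * p 1 N - q.a N 0" for N
    unfolding \<Phi>_1 by simp
  ultimately have p1: "(\<lambda>N. m\<^sub>1 N * p 1 N - q.a N 0) \<longlonglongrightarrow> 0" by (simp only: add_0_left)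
  show ?thesis
  proof (rule Lim_null_comparison)
    have "\<forall>\<^sub>F N in sequentially. \<bar>m\<^sub>1 N * p 1 N - q.a N 0\<bar> < c / 2"
      using tendstoD[OF p1, of "c / 2"] c(1) by (simp add: dist_real_def)
    then show "\<forall>\<^sub>F N in sequentially. norm (consec_coeff (l N) (\<mu> N) (B N) (n N) k - \<Phi> N k / q.a N 0)
        \<le> \<bar>m\<^sub>1 N * p k N - \<Phi> N k\<bar> * (2 / c) + \<bar>m\<^sub>1 N * p 1 N - q.a N 0\<bar> * (K * (2 / c) / c)"
    proof eventually_elim
      case (elim N)
      define x y where "x = m\<^sub>1 N * p k N" and "y = m\<^sub>1 N * p 1 N"
      have y: "c / 2 \<le> y" using elim c(2)[of N] unfolding y_def by linarith
      have a: "0 < q.a N 0" "0 < y" using c y less_le_trans[OF c(1) c(2)[of N]] by auto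
      have "q.z N ^ n N \<noteq> 0" "m\<^sub>1 N \<noteq> 0" using q.z_pos[of N] q.\<rho>2_ge[of N] by auto
      then have "consec_coeff (l N) (\<mu> N) (B N) (n N) k = x / y"
        unfolding q.consec_coeff_eq x_def y_def p_def by simp
      \<comment> \<open>The difference of the quotients is split so that each vanishing error is
        multiplied by something bounded uniformly in \<open>N\<close>.\<close>
      then have "consec_coeff (l N) (\<mu> N) (B N) (n N) k - \<Phi> N k / q.a N 0
          = (x - \<Phi> N k) * (1 / y) - (y - q.a N 0) * (\<Phi> N k * (1 / y) / q.a N 0)"
        using a by (simp add: field_simps)
      moreover have "\<bar>(x - \<Phi> N k) * (1 / y)\<bar> \<le> \<bar>x - \<Phi> N k\<bar> * (2 / c)"
        unfolding abs_mult using y a c(1) by (intro mult_left_mono) (auto simp: field_simps)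
      moreover have "\<bar>(y - q.a N 0) * (\<Phi> N k * (1 / y) / q.a N 0)\<bar> \<le> \<bar>y - q.a N 0\<bar> * (K * (2 / c) / c)"
      proof -
        have "\<Phi> N k * (1 / y) / q.a N 0 \<le> K * (2 / c) / c"
        proof -
          have "\<Phi> N k \<le> K" using \<Phi>_le[of N k] K(2)[of N] by linarith
          moreover have "1 / y \<le> 2 / c" using y c(1) a by (simp add: field_simps)
          ultimately have "\<Phi> N k * (1 / y) \<le> K * (2 / c)" using K0 a by (intro mult_mono) auto
          then show ?thesis using K0 c by (intro frac_le) auto
        qed
        moreover have "0 \<le> \<Phi> N k * (1 / y) / q.a N 0" using a \<Phi>_nonneg by simp
        ultimately show ?thesis unfolding abs_mult by (intro mult_left_mono) auto
      qed
      ultimately show ?case unfolding x_def[symmetric] y_def[symmetric] real_norm_def by linarith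
    qed
    have "(\<lambda>N. \<bar>m\<^sub>1 N * p k N - \<Phi> N k\<bar> * (2 / c) + \<bar>m\<^sub>1 N * p 1 N - q.a N 0\<bar> * (K * (2 / c) / c))
        \<longlonglongrightarrow> \<bar>0\<bar> * (2 / c) + \<bar>0\<bar> * (K * (2 / c) / c)"
      by (rule tendsto_add[OF tendsto_mult[OF tendsto_rabs[OF p] tendsto_const]
            tendsto_mult[OF tendsto_rabs[OF p1] tendsto_const]])
    then show "(\<lambda>N. \<bar>m\<^sub>1 N * p k N - \<Phi> N k\<bar> * (2 / c) + \<bar>m\<^sub>1 N * p 1 N - q.a N 0\<bar> * (K * (2 / c) / c))
        \<longlonglongrightarrow> 0" by simp
  qed
qed

lemma mean_consec_losses_limit:
  assumes n: "filterlim n at_top sequentially" and C: "(\<lambda>N. \<delta> N * real (n N)) \<longlonglongrightarrow> C"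
  shows "(\<lambda>N. mean_consec_losses (l N) (\<mu> N) (B N) (n N) k - exp (2 * C / \<rho>) * (\<Phi> N k / q.a N 0)) \<longlonglongrightarrow> 0"
proof -
  obtain c K where c: "0 < c" "\<And>N. c \<le> q.a N 0" and K: "\<And>N. 1 + \<delta> N \<le> K"
    using uniform_constants by metis
  let ?L = "\<lambda>N. mean_losses (l N) (\<mu> N) (B N) (n N)" and ?E = "exp (2 * C / \<rho>)"
  have L: "?L \<longlonglongrightarrow> ?E" by (rule mean_losses_limit[OF n C])
  have "(\<lambda>N. (consec_coeff (l N) (\<mu> N) (B N) (n N) k - \<Phi> N k / q.a N 0) * ?L N) \<longlonglongrightarrow> 0 * ?E"
    by (intro tendsto_mult consec_coeff_limit[OF n] L)
  moreover have "(\<lambda>N. \<Phi> N k / q.a N 0 * (?L N - ?E)) \<longlonglongrightarrow> 0"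
  proof (rule Lim_null_comparison[OF always_eventually])
    show "\<forall>N. norm (\<Phi> N k / q.a N 0 * (?L N - ?E)) \<le> K / c * \<bar>?L N - ?E\<bar>"
    proof
      fix N
      have "\<bar>\<Phi> N k / q.a N 0\<bar> \<le> K / c"
        using \<Phi>_le[of N k] \<Phi>_nonneg[of N k] K[of N] c(2)[of N] c(1) by (auto simp: abs_divide intro!: frac_le)
      then show "norm (\<Phi> N k / q.a N 0 * (?L N - ?E)) \<le> K / c * \<bar>?L N - ?E\<bar>"
        unfolding real_norm_def abs_mult by (rule mult_right_mono) simp
    qed
    have "(\<lambda>N. K / c * \<bar>?L N - ?E\<bar>) \<longlonglongrightarrow> K / c * \<bar>?E - ?E\<bar>"
      using c(1) by (intro tendsto_mult tendsto_const tendsto_rabs tendsto_diff L)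
    then show "(\<lambda>N. K / c * \<bar>?L N - ?E\<bar>) \<longlonglongrightarrow> 0" by simp
  qed
  ultimately have "(\<lambda>N. (consec_coeff (l N) (\<mu> N) (B N) (n N) k - \<Phi> N k / q.a N 0) * ?L N
      + \<Phi> N k / q.a N 0 * (?L N - ?E)) \<longlonglongrightarrow> 0 * ?E + 0"
    by (rule tendsto_add)
  then show ?thesis by (simp add: mean_consec_losses_def algebra_simps)
qed

text \<open>Supplies the dominating constant, hence covers small \<open>n\<close> as well:
  \<open>D\<close> is at most \<open>1 / z ^ n\<close> times a bounded factor, and \<open>Q\<close>
  has bounded mass.\<close>

lemma mean_consec_losses_bounded:
  assumes k: "1 \<le> k"
  obtains K where "\<And>N n. \<delta> N * real n \<le> R \<Longrightarrow> \<bar>mean_consec_losses (l N) (\<mu> N) (B N) n k\<bar> \<le> K"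
proof -
  obtain c K where c: "0 < c" "\<And>N. c \<le> q.a N 0" and K: "\<And>N. m\<^sub>2 N \<le> K"
    using uniform_constants by metis
  obtain Y where Y: "0 < Y" "\<And>N n. D\<^sub>z N n \<le> Y" using Dz_bounded by blast
  have m: "m\<^sub>1 N \<le> K" for N using K[of N] q.\<rho>3_nonneg[of N] by simp
  have "\<bar>mean_consec_losses (l N) (\<mu> N) (B N) n k\<bar> \<le> K + exp (\<bar>R\<bar> / c) * Y * K"
    if R: "\<delta> N * real n \<le> R" for N n
  proof (cases "n = 0")
    \<comment> \<open>Both sums of \<open>consec_coeff\<close> are empty, and 0 / 0 is 0.\<close>
    case True
    have "0 \<le> K" using m[of 0] q.\<rho>2_ge[of 0] by simp
    then show ?thesis using Y True by (simp add: mean_consec_losses_def consec_coeff_def)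
  next
    case False
    have Q: "(\<Sum>m\<in>A. q.Q N m) \<le> K" if "finite A" for A
      using sum_le_suminf[OF sums_summable[OF q.Q_sums] that, of N] q.Q_nonneg[of N] sums_unique[OF q.Q_sums, of N] m[of N]
      by auto
    have "(\<Sum>m<n. q.Q N m * q.D N (n - m)) \<le> (\<Sum>m<n. q.Q N m * (exp (\<bar>R\<bar> / c) * Y))"
    proof (intro sum_mono mult_left_mono q.Q_nonneg)
      fix m
      have "q.D N (n - m) = 1 / q.z N ^ (n - m) * D\<^sub>z N (n - m)" using q.z_pos[of N] by (simp add: D\<^sub>z_def)
      also have "\<dots> \<le> exp (\<bar>R\<bar> / c) * Y"
      proof (intro mult_mono Y Dz_nonneg)
        have "1 / q.z N ^ (n - m) \<le> exp (\<delta> N * real (n - m) / q.a N 0)" by (rule q.inverse_z_pow_le)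
        also have "\<dots> \<le> exp (\<bar>R\<bar> / c)"
        proof -
          have "\<delta> N * real (n - m) \<le> \<delta> N * real n" using q.\<delta>[of N] by (intro mult_left_mono) auto
          then have "\<delta> N * real (n - m) \<le> \<bar>R\<bar>" using R by linarith
          then show ?thesis using c q.\<delta>[of N] by (auto intro!: frac_le)
        qed
        finally show "1 / q.z N ^ (n - m) \<le> exp (\<bar>R\<bar> / c)" .
      qed auto
      finally show "q.D N (n - m) \<le> exp (\<bar>R\<bar> / c) * Y" .
    qed
    also have "\<dots> \<le> exp (\<bar>R\<bar> / c) * Y * K"
    proof -
      have "(\<Sum>m<n. q.Q N m * (exp (\<bar>R\<bar> / c) * Y)) = exp (\<bar>R\<bar> / c) * Y * (\<Sum>m<n. q.Q N m)"
        by (simp only: sum_distrib_left mult.commute)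
      also have "\<dots> \<le> exp (\<bar>R\<bar> / c) * Y * K" using Q[of "{..<n}"] Y by (intro mult_left_mono) auto
      finally show ?thesis .
    qed
    finally have "mean_losses (l N) (\<mu> N) (B N) n \<le> K + exp (\<bar>R\<bar> / c) * Y * K"
      using q.mean_losses_eq[of n N] False Q[of "{n - 1}"] by simp
    moreover have "0 \<le> mean_losses (l N) (\<mu> N) (B N) n"
      using q.mean_losses_eq[of n N] False q.Q_nonneg[of N] q.D_nonneg[of N] by (simp add: sum_nonneg)
    ultimately have "\<bar>mean_losses (l N) (\<mu> N) (B N) n\<bar> \<le> K + exp (\<bar>R\<bar> / c) * Y * K" by simp
    then have "\<bar>consec_coeff (l N) (\<mu> N) (B N) n k\<bar> * \<bar>mean_losses (l N) (\<mu> N) (B N) n\<bar>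
        \<le> 1 * (K + exp (\<bar>R\<bar> / c) * Y * K)"
      using q.consec_coeff_bounds[OF k, of N n] by (intro mult_mono) auto
    then show ?thesis by (simp add: mean_consec_losses_def abs_mult)
  qed
  then show ?thesis by (rule that)
qed

end

subsection \<open>Averaging over the buffer content\<close>

text \<open>Positive packet counts make the set under the supremum finite; by maximality one more
  message overflows \<open>N\<close>, and each message has at most \<open>u\<close> packets.\<close>

lemma zeta_bounds:
  assumes \<kappa>: "\<And>i. 1 \<le> i \<Longrightarrow> 1 \<le> \<kappa> i \<omega> \<and> \<kappa> i \<omega> \<le> u"
  shows "zeta \<kappa> N \<omega> \<le> N" "N < u * Suc (zeta \<kappa> N \<omega>)"
proof -
  define S where "S = {m. (\<Sum>i=1..m. \<kappa> i \<omega>) \<le> N}"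
  have "m \<le> (\<Sum>i=1..m. \<kappa> i \<omega>)" for m
    using sum_mono[of "{1..m}" "\<lambda>_. 1" "\<lambda>i. \<kappa> i \<omega>"] \<kappa> by simp
  then have sub: "S \<subseteq> {..N}" unfolding S_def by (auto intro: order_trans)
  then have fin: "finite S" by (rule finite_subset) simp
  have ne: "S \<noteq> {}" unfolding S_def by (auto intro: exI[of _ 0])
  \<comment> \<open>On \<open>nat\<close> the supremum of a nonempty set is \<open>Max\<close>,
    which is informative only because the set is finite.\<close>
  have z: "zeta \<kappa> N \<omega> = Max S"
  proof -
    have "zeta \<kappa> N \<omega> = Sup S" by (simp add: zeta_def S_def)
    then show ?thesis using ne by (simp add: Sup_nat_def)
  qed
  show "zeta \<kappa> N \<omega> \<le> N" using Max_in[OF fin ne] sub z by auto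
  have "Suc (zeta \<kappa> N \<omega>) \<notin> S"
    using Max_ge[OF fin, of "Suc (Max S)"] z by auto
  then have "N < (\<Sum>i=1..Suc (zeta \<kappa> N \<omega>). \<kappa> i \<omega>)" unfolding S_def by (simp add: not_le)
  also have "\<dots> \<le> (\<Sum>i=1..Suc (zeta \<kappa> N \<omega>). u)" using \<kappa> by (intro sum_mono) auto
  finally show "N < u * Suc (zeta \<kappa> N \<omega>)" by (simp add: mult.commute)
qed

text \<open>Integrability of the third power is stated apart from the bound: a non-integrable
  function has integral 0, so bounded values of \<open>rho_moment\<close> would not make the moment
  finite.\<close>

theorem theorem8p2:
  fixes M :: "'a measure" and \<kappa> :: "nat \<Rightarrow> 'a \<Rightarrow> nat" and \<kappa>lo \<kappa>up :: nat
    and zlo zup :: "nat \<Rightarrow> nat"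
    and l \<mu> \<delta> :: "nat \<Rightarrow> real" and B :: "nat \<Rightarrow> real measure"
    and C \<rho>2 :: real and k :: nat
  assumes "prob_space M"
    and "packet_sequence M \<kappa> \<kappa>lo \<kappa>up"
    and "\<And>N. AE \<omega> in M. zlo N \<le> zeta \<kappa> N \<omega> \<and> zeta \<kappa> N \<omega> \<le> zup N"
    and "filterlim zlo at_top sequentially"
    and "filterlim zup at_top sequentially"
    and "\<And>N. 0 < l N"
    and "\<And>N. service_distribution (B N) (\<mu> N)"
    and "1 \<le> k"
    and "\<And>N. l N / \<mu> N = 1 + \<delta> N"
    and "\<And>N. 0 < \<delta> N"
    and "\<delta> \<longlonglongrightarrow> 0"
    and "0 \<le> C"
    and "AE \<omega> in M. (\<lambda>N. \<delta> N * real (zeta \<kappa> N \<omega>)) \<longlonglongrightarrow> C"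
    and "\<And>N. integrable (B N) (\<lambda>x. (l N * x) ^ 3)"
    and "Bseq (\<lambda>N. rho_moment (l N) (B N) 3)"
    and "(\<lambda>N. rho_moment (l N) (B N) 2) \<longlonglongrightarrow> \<rho>2"
  shows "(\<lambda>N. mean_consec_refused M \<kappa> (zlo N) (zup N) (l N) (\<mu> N) (B N) N k
           - exp (2 * C / \<rho>2) *
             ((\<Sum>\<^sub>\<infinity>i\<in>{1..}. real i * arrivals_prob (l N) (B N) (i + k))
               / laplace_stieltjes (B N) (l N))) \<longlonglongrightarrow> 0"
proof -
  interpret prob_space M by (rule assms(1))
  interpret heavy_traffic l \<mu> \<delta> B \<rho>2
    using assms by unfold_locales auto
  have \<kappa>_meas [measurable]: "\<kappa> i \<in> measurable M (count_space UNIV)" if "1 \<le> i" for i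
    using assms(2) that unfolding packet_sequence_def indep_vars_def by auto
  have zeta_meas [measurable]: "zeta \<kappa> N \<in> measurable M (count_space UNIV)" for N
    unfolding zeta_def by measurable
  have "AE \<omega> in M. \<kappa>lo \<le> \<kappa> i \<omega> \<and> \<kappa> i \<omega> \<le> \<kappa>up" if "1 \<le> i" for i
  proof -
    have "{\<omega> \<in> space M. \<kappa>lo \<le> \<kappa> i \<omega> \<and> \<kappa> i \<omega> \<le> \<kappa>up} \<in> events" using \<kappa>_meas[OF that] by measurable
    then show ?thesis using assms(2) that unfolding packet_sequence_def by (subst prob_Collect_eq_1[symmetric]) auto
  qed
  then have "AE \<omega> in M. \<forall>i\<in>{1..}. \<kappa>lo \<le> \<kappa> i \<omega> \<and> \<kappa> i \<omega> \<le> \<kappa>up"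
    by (intro AE_ball_countable'[OF _ countableI_type]) auto
  moreover have "1 \<le> \<kappa>lo" using assms(2) unfolding packet_sequence_def by blast
  ultimately have \<kappa>_AE: "AE \<omega> in M. \<forall>i\<ge>1. 1 \<le> \<kappa> i \<omega> \<and> \<kappa> i \<omega> \<le> \<kappa>up"
    by (auto elim!: eventually_mono intro: order_trans)
  \<comment> \<open>convergence along one sample path bounds \<open>\<delta> N * N\<close>, and thus \<open>\<delta> N * zeta \<kappa> N\<close> along almost all paths\<close>
  obtain R where R: "\<And>N. \<delta> N * real N \<le> R"
  proof -
    have "AE \<omega> in M. (\<forall>i\<ge>1. 1 \<le> \<kappa> i \<omega> \<and> \<kappa> i \<omega> \<le> \<kappa>up) \<and> (\<lambda>N. \<delta> N * real (zeta \<kappa> N \<omega>)) \<longlonglongrightarrow> C"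
      using \<kappa>_AE assms(13) by eventually_elim simp
    then obtain \<omega> where \<omega>: "\<And>i. 1 \<le> i \<Longrightarrow> 1 \<le> \<kappa> i \<omega> \<and> \<kappa> i \<omega> \<le> \<kappa>up"
      "(\<lambda>N. \<delta> N * real (zeta \<kappa> N \<omega>)) \<longlonglongrightarrow> C"
      using eventually_happens'[OF ae_filter_bot] by blast
    have "(\<lambda>N. real \<kappa>up * (\<delta> N * real (zeta \<kappa> N \<omega>) + \<delta> N)) \<longlonglongrightarrow> real \<kappa>up * (C + 0)"
      by (intro tendsto_intros \<omega>(2) \<delta>_lim)
    then obtain R where R: "\<And>N. \<bar>real \<kappa>up * (\<delta> N * real (zeta \<kappa> N \<omega>) + \<delta> N)\<bar> \<le> R"
      using convergent_imp_Bseq[OF convergentI] by (force elim!: BseqE)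
    have "\<delta> N * real N \<le> R" for N
    proof -
      have "real N \<le> real (\<kappa>up * Suc (zeta \<kappa> N \<omega>))"
        using zeta_bounds(2)[of \<kappa> \<omega> \<kappa>up N, OF \<omega>(1)] by (simp only: of_nat_le_iff less_imp_le)
      then have "\<delta> N * real N \<le> \<delta> N * real (\<kappa>up * Suc (zeta \<kappa> N \<omega>))"
        using assms(10)[of N] by (intro mult_left_mono) auto
      also have "\<dots> = real \<kappa>up * (\<delta> N * real (zeta \<kappa> N \<omega>) + \<delta> N)" by (simp add: algebra_simps)
      also have "\<dots> \<le> R" using R[of N] by linarith
      finally show ?thesis .
    qed
    then show ?thesis by (rule that)
  qed
  obtain K where K: "\<And>N n. \<delta> N * real n \<le> R \<Longrightarrow> \<bar>mean_consec_losses (l N) (\<mu> N) (B N) n k\<bar> \<le> K"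
    using mean_consec_losses_bounded[OF assms(8)] by blast
  define G where "G N = exp (2 * C / \<rho>2) * (\<Phi> N k / q.a N 0)" for N
  obtain K' where K': "\<And>N. \<bar>G N\<bar> \<le> K'"
  proof -
    obtain c K where c: "0 < c" "\<And>N. c \<le> q.a N 0" "\<And>N. 1 + \<delta> N \<le> K"
      using uniform_constants by metis
    have *: "\<bar>\<Phi> N k / q.a N 0\<bar> \<le> K / c" for N
      using \<Phi>_le[of N k] \<Phi>_nonneg[of N k] c(3)[of N] c(2)[of N] c(1) by (auto simp: abs_divide intro!: frac_le)
    have "\<bar>G N\<bar> \<le> exp (2 * C / \<rho>2) * (K / c)" for N
      unfolding G_def abs_mult[of "exp _"] abs_exp_cancel
      by (intro mult_left_mono * less_imp_le exp_gt_zero)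
    then show ?thesis by (rule that)
  qed
  \<comment> \<open>The random variable behind the total expectation formula; on a sample path it is
    covered by \<open>mean_consec_losses_limit\<close> with \<open>zeta\<close> as the index
    sequence.\<close>
  define F where "F N \<omega> = mean_consec_losses (l N) (\<mu> N) (B N) (zeta \<kappa> N \<omega>) k" for N \<omega>
  have F_meas [measurable]: "F N \<in> borel_measurable M" for N
    unfolding F_def by measurable
  have F_bounded: "AE \<omega> in M. \<bar>F N \<omega>\<bar> \<le> K" for N
    using \<kappa>_AE
  proof eventually_elim
    case (elim \<omega>)
    then have "real (zeta \<kappa> N \<omega>) \<le> real N" using zeta_bounds(1)[of \<kappa> \<omega> \<kappa>up N] by auto
    then have "\<delta> N * real (zeta \<kappa> N \<omega>) \<le> R"
      using R[of N] mult_left_mono[of _ _ "\<delta> N"] assms(10)[of N] by (meson less_imp_le order_trans)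
    then show ?case unfolding F_def by (rule K)
  qed
  have "AE \<omega> in M. \<forall>N. zlo N \<le> zeta \<kappa> N \<omega> \<and> zeta \<kappa> N \<omega> \<le> zup N"
    using assms(3) by (simp add: AE_all_countable)
  with assms(13) have F_lim: "AE \<omega> in M. (\<lambda>N. F N \<omega> - G N) \<longlonglongrightarrow> 0"
  proof eventually_elim
    case (elim \<omega>)
    have "filterlim (\<lambda>N. zeta \<kappa> N \<omega>) at_top sequentially"
      by (rule filterlim_at_top_mono[OF assms(4)]) (use elim in auto)
    from mean_consec_losses_limit[OF this elim(1)] show ?case
      unfolding F_def G_def .
  qed
  have "(\<lambda>N. LINT \<omega>|M. F N \<omega> - G N) \<longlonglongrightarrow> (LINT \<omega>|M. 0)"
  proof (rule integral_dominated_convergence[where w = "\<lambda>_. K + K'"])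
    show "AE \<omega> in M. norm (F N \<omega> - G N) \<le> K + K'" for N
      using F_bounded[of N]
    proof eventually_elim
      case (elim \<omega>)
      then show ?case using K'[of N] by simp
    qed
  qed (use F_lim in auto)
  moreover have "(LINT \<omega>|M. F N \<omega> - G N)
      = mean_consec_refused M \<kappa> (zlo N) (zup N) (l N) (\<mu> N) (B N) N k - G N" for N
  proof -
    have int: "integrable M (F N)"
      using F_bounded by (intro integrable_const_bound[where B = K]) auto
    \<comment> \<open>Almost surely \<open>zeta\<close> lies between \<open>zlo N\<close> and
      \<open>zup N\<close>, so exactly one indicator is 1.\<close>
    have "(LINT \<omega>|M. F N \<omega>) = (LINT \<omega>|M. (\<Sum>i=zlo N..zup N. mean_consec_losses (l N) (\<mu> N) (B N) i k
        * indicator {\<omega> \<in> space M. zeta \<kappa> N \<omega> = i} \<omega>))"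
    proof (rule integral_cong_AE)
      show "AE \<omega> in M. F N \<omega> = (\<Sum>i=zlo N..zup N. mean_consec_losses (l N) (\<mu> N) (B N) i k
        * indicator {\<omega> \<in> space M. zeta \<kappa> N \<omega> = i} \<omega>)"
        using assms(3)[of N] AE_space
      proof eventually_elim
        case (elim \<omega>)
        then have "(\<Sum>i=zlo N..zup N. mean_consec_losses (l N) (\<mu> N) (B N) i k
            * indicator {\<omega> \<in> space M. zeta \<kappa> N \<omega> = i} \<omega>)
          = (\<Sum>i=zlo N..zup N. if i = zeta \<kappa> N \<omega> then F N \<omega> else 0)"
          by (intro sum.cong) (auto simp: F_def)
        then show ?case using elim by simp
      qed
    qed measurable
    also have "\<dots> = mean_consec_refused M \<kappa> (zlo N) (zup N) (l N) (\<mu> N) (B N) N k"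
      unfolding mean_consec_refused_def
    proof (subst Bochner_Integration.integral_sum)
      have ev: "{\<omega> \<in> space M. zeta \<kappa> N \<omega> = i} \<in> events" for i by measurable
      then have "integrable M (indicat_real {\<omega> \<in> space M. zeta \<kappa> N \<omega> = i})" for i
        by (rule integrable_real_indicator) (simp add: emeasure_eq_measure)
      then show "integrable M (\<lambda>\<omega>. mean_consec_losses (l N) (\<mu> N) (B N) i k
        * indicator {\<omega> \<in> space M. zeta \<kappa> N \<omega> = i} \<omega>)" for i by simp
    qed (auto intro!: sum.cong)
    finally show ?thesis using int prob_space by simp
  qed
  ultimately show ?thesis
    unfolding G_def \<Phi>_def q.a0_eq by simp
qed

end
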